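(* Let $n,d$ be integers with $1\le d<n$, and suppose we are given a set of $n$ items, at most $d$ of which are defective. Then the Chinese Remainder Sieve method can identify the defective items (for a suitable choice of its sequence of prime powers, whose product is at least $n^d$) using a number of tests $$t(n,d) < \frac{\lceil 2d\ln n\rceil^2}{2\ln \lceil 2d\ln n\rceil}\left(1 + \frac{1.2762}{\ln \lceil 2d\ln n\rceil}\right).$$ The sample rate can be bounded by $$S(n,d) < \frac{\lceil 2d\ln n\rceil}{2\ln \lceil 2d\ln n\rceil}\left(1 + \frac{1.2762}{\ln \lceil 2d\ln n\rceil}\right),$$ and the analysis time $A(n,t)$ is $O(n\, t(n,d))$.
   Context: Combinatorial group testing: among $n$ items, numbered $0,1,\dots,n-1$, an unknown set of at most $d$ items is defective. A test is a subset of the items; its outcome is positive if it contains at least one defective item, and negative otherwise. In a non-adaptive method all tests are fixed in advance (rows of a Boolean $t\times n$ matrix $M$, with $M[r,i]=1$ iff item $i$ is in test $r$), and the defective set must be determined from the outcomes. Chinese Remainder Sieve method: choose a sequence $p_1^{e_1},\dots,p_k^{e_k}$ of powers of distinct primes with $\prod_j p_j^{e_j}\ge n^d$. For each $j$ and each $x$ with $0\le x<p_j^{e_j}$, there is one test, consisting of all item indices $i\in\{0,\dots,n-1\}$ with $i\equiv x \pmod{p_j^{e_j}}$. The total number of tests is $t=\sum_{j=1}^k p_j^{e_j}$. $t(n,d)$ denotes the number of tests used; $S(n,d)$ (the sampling rate) denotes the maximum number of tests in which any single item is included; $A(n,t)$ denotes the time needed to determine, from the test outcomes, which items are defective. *)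

theory Defs
  imports Complex_Main "HOL-Number_Theory.Cong" "HOL-Computational_Algebra.Primes"
begin

text \<open>A non-adaptive method is the list of the rows of its test matrix, each row given as
  a set of items. It is a list because empty and repeated tests count as tests.\<close>

definition outcomes :: "nat set list \<Rightarrow> nat set \<Rightarrow> bool list" where
  "outcomes T D = map (\<lambda>R. R \<inter> D \<noteq> {}) T"

definition defective_sets :: "nat \<Rightarrow> nat \<Rightarrow> nat set set" where
  "defective_sets n d = {D. D \<subseteq> {..<n} \<and> card D \<le> d}"

definition identifies :: "nat set list \<Rightarrow> nat \<Rightarrow> nat \<Rightarrow> bool" where
  "identifies T n d \<longleftrightarrow> inj_on (outcomes T) (defective_sets n d)"

definition sampling_rate :: "nat set list \<Rightarrow> nat \<Rightarrow> nat" where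
  "sampling_rate T n = Max ((\<lambda>i. length (filter (\<lambda>R. i \<in> R) T)) ` {..<n})"

text \<open>The pair \<open>(p, e)\<close> in a sequence stands for the prime power \<open>p ^ e\<close>.\<close>

definition moduli :: "(nat \<times> nat) list \<Rightarrow> nat list" where
  "moduli ps = map (\<lambda>(p, e). p ^ e) ps"

definition crs_sequence :: "nat \<Rightarrow> nat \<Rightarrow> (nat \<times> nat) list \<Rightarrow> bool" where
  "crs_sequence n d ps \<longleftrightarrow>
     (\<forall>(p, e) \<in> set ps. prime p \<and> e \<ge> 1) \<and> distinct (map fst ps) \<and>
     prod_list (moduli ps) \<ge> n ^ d"

definition crs_tests :: "nat \<Rightarrow> (nat \<times> nat) list \<Rightarrow> nat set list" where
  "crs_tests n ps =
     concat (map (\<lambda>q. map (\<lambda>x. {i. i < n \<and> [i = x] (mod q)}) [0..<q]) (moduli ps))"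

lemma length_crs_tests: "length (crs_tests n ps) = (\<Sum>(p, e)\<leftarrow>ps. p ^ e)"
  by (simp add: crs_tests_def moduli_def length_concat comp_def case_prod_unfold)

text \<open>Analysis time is measured on a unit-cost random access machine with structured control
  flow: finitely many registers are used by a program, memory is addressed indirectly, and the
  only arithmetic is addition and (truncated) subtraction. Every elementary instruction and
  every evaluation of a branch or loop condition costs one step. Register operands are given by
  their number.\<close>

datatype com =
    Skip
  | Const nat nat
  | Add nat nat nat
  | Sub nat nat nat
  | Load nat nat
  | Store nat nat
  | Seq com com
  | IfLess nat nat com com
  | WhileLess nat nat com

type_synonym state = "(nat \<Rightarrow> nat) \<times> (nat \<Rightarrow> nat)" \<comment> \<open>registers, memory\<close>

inductive exec :: "com \<Rightarrow> state \<Rightarrow> nat \<Rightarrow> state \<Rightarrow> bool" where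
  Skip: "exec Skip s 1 s"
| Const: "exec (Const a c) (r, m) 1 (r(a := c), m)"
| Add: "exec (Add a b c) (r, m) 1 (r(a := r b + r c), m)"
| Sub: "exec (Sub a b c) (r, m) 1 (r(a := r b - r c), m)"
| Load: "exec (Load a b) (r, m) 1 (r(a := m (r b)), m)"
| Store: "exec (Store a b) (r, m) 1 (r, m(r a := r b))"
| Seq: "exec P s k s' \<Longrightarrow> exec Q s' l s'' \<Longrightarrow> exec (Seq P Q) s (k + l) s''"
| IfTrue: "r a < r b \<Longrightarrow> exec P (r, m) k s' \<Longrightarrow> exec (IfLess a b P Q) (r, m) (k + 1) s'"
| IfFalse: "\<not> r a < r b \<Longrightarrow> exec Q (r, m) k s' \<Longrightarrow> exec (IfLess a b P Q) (r, m) (k + 1) s'"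
| WhileTrue: "r a < r b \<Longrightarrow> exec P (r, m) k s' \<Longrightarrow> exec (WhileLess a b P) s' l s'' \<Longrightarrow>
    exec (WhileLess a b P) (r, m) (k + l + 1) s''"
| WhileFalse: "\<not> r a < r b \<Longrightarrow> exec (WhileLess a b P) (r, m) 1 (r, m)"

text \<open>The analysis knows the tests (through \<open>n\<close> and the moduli) and the outcomes, but not the
  defective set. Registers 0, 1 and 2 initially hold \<open>n\<close>, the number of moduli and the
  number of tests; memory holds the moduli followed by the outcomes (1 for positive). The
  characteristic vector of the defective set is to be left in the \<open>n\<close> cells after these.\<close>

definition analysis_input :: "nat \<Rightarrow> nat list \<Rightarrow> bool list \<Rightarrow> state" where
  "analysis_input n qs bs =
     (let xs = qs @ map of_bool bs in
      ((\<lambda>_. 0)(0 := n, 1 := length qs, 2 := length bs),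
       \<lambda>a. if a < length xs then xs ! a else 0))"

definition analysis_output :: "nat \<Rightarrow> nat list \<Rightarrow> bool list \<Rightarrow> nat set \<Rightarrow> state \<Rightarrow> bool" where
  "analysis_output n qs bs D s \<longleftrightarrow>
     (\<forall>i<n. snd s (length qs + length bs + i) = of_bool (i \<in> D))"

definition analyses_within :: "com \<Rightarrow> nat \<Rightarrow> nat \<Rightarrow> (nat \<times> nat) list \<Rightarrow> nat \<Rightarrow> bool" where
  "analyses_within P n d ps B \<longleftrightarrow>
     (\<forall>D \<in> defective_sets n d.
        let qs = moduli ps; bs = outcomes (crs_tests n ps) D in
        \<exists>k s. exec P (analysis_input n qs bs) k s \<and> analysis_output n qs bs D s \<and> k \<le> B)"

end

theory Submission
  imports Defs "HOL-Number_Theory.Prime_Powers" "HOL-Analysis.Harmonic_Numbers"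
begin

text \<open>Put \<open>L = \<lceil>2 d ln n\<rceil>\<close>, so that \<open>n\<^sup>d \<le> e\<^bsup>L/2\<^esup>\<close>. An item \<open>i\<close> outside the defective set \<open>D\<close> that
  lies only in positive tests would make every modulus divide \<open>\<Prod>x\<in>D. \<bar>x - i\<bar>\<close>, which is positive and
  less than \<open>n\<^sup>d\<close>; hence \<open>D\<close> consists of the items all of whose tests are positive. This
  criterion identifies \<open>D\<close> and is evaluated by scanning the items once per modulus.

  Every item is in exactly one test per modulus, so the bounds ask for few moduli of size at most about
  \<open>L\<close> with product at least \<open>e\<^bsup>L/2\<^esup>\<close>. Small primes are wasteful here: using all primes up to about
  \<open>L/2\<close> gives too many moduli. Instead we take, for \<open>L \<ge> 4000\<close>, prime powers between \<open>7L/20\<close> and \<open>L\<close>;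
  Chebyshev's estimates give \<open>\<psi>(L) - \<psi>(7L/20) \<ge> L/2\<close>, and \<open>ln (20/7) < 1.2762\<close> leaves enough room in the
  bound on their number. For \<open>L < 4000\<close> a table lists suitable runs of consecutive primes.\<close>

section \<open>Residue class tests\<close>

abbreviation test_class :: "nat \<Rightarrow> nat \<Rightarrow> nat \<Rightarrow> nat set" where
  "test_class n q x \<equiv> {i. i < n \<and> [i = x] (mod q)}"

lemma coprime_prod_list_right:
  fixes a :: nat
  assumes "\<And>b. b \<in> set xs \<Longrightarrow> coprime a b"
  shows "coprime a (prod_list xs)"
  using assms by (induction xs) auto

text \<open>Powers of distinct primes are pairwise coprime, so their divisibilities combine; in the
  induction the head power is coprime to the product of the tail.\<close>

lemma prod_moduli_dvd:
  assumes "\<forall>(p, e) \<in> set ps. prime p" "distinct (map fst ps)"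
    and "\<And>q. q \<in> set (moduli ps) \<Longrightarrow> q dvd m"
  shows "prod_list (moduli ps) dvd m"
  using assms
proof (induction ps)
  case Nil
  then show ?case by (simp add: moduli_def)
next
  case (Cons pe ps)
  obtain p e where pe: "pe = (p, e)" by force
  have IH: "prod_list (moduli ps) dvd m"
    using Cons.prems by (intro Cons.IH) (auto simp: moduli_def)
  have "coprime (p ^ e) (prod_list (moduli ps))"
  proof (rule coprime_prod_list_right)
    fix b assume "b \<in> set (moduli ps)"
    then obtain p' e' where b: "b = p' ^ e'" "(p', e') \<in> set ps"
      by (auto simp: moduli_def)
    have "p' \<in> fst ` set ps" using b(2) by (rule rev_image_eqI) simp
    then have "p' \<noteq> p" using Cons.prems(2) by (auto simp: pe)
    moreover have "prime p'" "prime p" using Cons.prems(1) b(2) by (auto simp: pe)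
    ultimately show "coprime (p ^ e) b"
      using primes_coprime[of p p'] by (simp add: b(1))
  qed
  moreover have "p ^ e dvd m"
    using Cons.prems(3) by (simp add: pe moduli_def)
  ultimately show ?case
    using IH by (simp add: pe moduli_def divides_mult)
qed

text \<open>For an item \<open>i\<close>, the class of \<open>i mod q\<close> is the only test for
  modulus \<open>q\<close> that contains \<open>i\<close>, so this says that \<open>i\<close> lies
  in no negative test, which the outcomes alone reveal.\<close>

definition passes_all :: "nat \<Rightarrow> (nat \<times> nat) list \<Rightarrow> nat set \<Rightarrow> nat \<Rightarrow> bool" where
  "passes_all n ps D i \<longleftrightarrow> (\<forall>q \<in> set (moduli ps). test_class n q (i mod q) \<inter> D \<noteq> {})"

lemma mem_defective_iff:
  assumes crs: "crs_sequence n d ps" and n: "2 \<le> n" and d: "1 \<le> d" and D: "D \<in> defective_sets n d" and i: "i < n"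
  shows "i \<in> D \<longleftrightarrow> passes_all n ps D i"
proof
  assume "i \<in> D"
  then show "passes_all n ps D i"
    using i unfolding passes_all_def by (auto simp: cong_def)
next
  assume pass: "passes_all n ps D i"
  show "i \<in> D"
  proof (rule ccontr)
    assume iD: "i \<notin> D"
    have Dn: "D \<subseteq> {..<n}" "card D \<le> d" and fin: "finite D"
      using D finite_subset[of D "{..<n}"] by (auto simp: defective_sets_def)
    define m where "m = (\<Prod>x\<in>D. nat \<bar>int x - int i\<bar>)"
    have "m > 0" unfolding m_def using iD by (intro prod_pos) auto
    have "prod_list (moduli ps) dvd m"
    proof (rule prod_moduli_dvd)
      fix q assume "q \<in> set (moduli ps)"
      then obtain x where x: "x \<in> D" "[x = i mod q] (mod q)"
        using pass unfolding passes_all_def by blast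
      then have "[int x = int i] (mod int q)"
        by (simp add: cong_def flip: of_nat_mod)
      then have "q dvd nat \<bar>int x - int i\<bar>"
        using nat_dvd_iff int_dvd_int_iff by (auto simp: cong_iff_dvd_diff dvd_nat_abs_iff)
      also have "\<dots> dvd m"
        unfolding m_def by (rule dvd_prodI[OF fin x(1)])
      finally show "q dvd m" .
    qed (use crs in \<open>auto simp: crs_sequence_def\<close>)
    then have "n ^ d \<le> m"
      using crs \<open>m > 0\<close> by (auto simp: crs_sequence_def dest!: dvd_imp_le)
    also have "m \<le> (\<Prod>x\<in>D. n - 1)"
      unfolding m_def using Dn i by (intro prod_mono) auto
    also have "\<dots> = (n - 1) ^ card D" by simp
    also have "\<dots> < n ^ d"
    \<comment> \<open>For empty \<open>D\<close> the left side is the empty product 1, and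
      strictness comes from \<open>n \<ge> 2\<close> and \<open>d \<ge> 1\<close>; otherwise it
      comes from \<open>n - 1 < n\<close>.\<close>
    proof (cases "card D = 0")
      case True
      then show ?thesis using n d using one_less_power[of n d] by simp
    next
      case False
      then have "(n - 1) ^ card D < n ^ card D"
        using n by (intro power_strict_mono) auto
      also have "\<dots> \<le> n ^ d" using Dn n by (intro power_increasing) auto
      finally show ?thesis .
    qed
    finally show False by simp
  qed
qed

text \<open>The criterion of \<open>mem_defective_iff\<close> depends on \<open>D\<close> only
  through the outcomes, so equal outcomes force equal sets.\<close>

lemma identifies_crs_tests:
  assumes crs: "crs_sequence n d ps" and n: "2 \<le> n" and d: "1 \<le> d"
  shows "identifies (crs_tests n ps) n d"
  unfolding identifies_def
proof (rule inj_onI)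
  fix D E assume D: "D \<in> defective_sets n d" and E: "E \<in> defective_sets n d"
    and eq: "outcomes (crs_tests n ps) D = outcomes (crs_tests n ps) E"
  have same: "test_class n q (i mod q) \<inter> D \<noteq> {} \<longleftrightarrow> test_class n q (i mod q) \<inter> E \<noteq> {}"
    if q: "q \<in> set (moduli ps)" for q i
  proof -
    from q have "q > 0" using crs
      by (auto simp: moduli_def crs_sequence_def prime_gt_0_nat)
    then have "test_class n q (i mod q) \<in> set (map (test_class n q) [0..<q])"
      unfolding set_map by (intro imageI) simp
    then have "test_class n q (i mod q) \<in> set (crs_tests n ps)"
      using q unfolding crs_tests_def set_concat set_map[of _ "moduli ps"] by blast
    with eq show ?thesis unfolding outcomes_def map_eq_conv by blast
  qed
  have "passes_all n ps D i \<longleftrightarrow> passes_all n ps E i" for i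
    unfolding passes_all_def using same by blast
  then have "i \<in> D \<longleftrightarrow> i \<in> E" if "i < n" for i
    using mem_defective_iff[OF crs n d D that] mem_defective_iff[OF crs n d E that] by simp
  then show "D = E" using D E by (auto simp: defective_sets_def)
qed

section \<open>The number of tests containing an item\<close>

lemma length_filter_residue_classes:
  assumes "i < n" "0 < q"
  shows "length (filter (\<lambda>R. i \<in> R) (map (test_class n q) [0..<q])) = 1"
proof -
  have "length (filter (\<lambda>R. i \<in> R) (map (test_class n q) [0..<q])) =
      length (filter (\<lambda>x. x = i mod q) [0..<q])"
    unfolding filter_map length_map
    by (rule arg_cong[where f = length], rule filter_cong) (use assms in \<open>auto simp: cong_def\<close>)
  also have "\<dots> = card ({x. x = i mod q} \<inter> set [0..<q])"
    by (rule distinct_length_filter) simp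
  also have "{x. x = i mod q} \<inter> set [0..<q] = {i mod q}"
    using assms(2) by auto
  finally show ?thesis by simp
qed

text \<open>Each modulus contributes exactly one test containing a given item, so the maximum is
  taken over a singleton.\<close>

lemma sampling_rate_crs_tests:
  assumes "0 < n" "0 \<notin> set (moduli ps)"
  shows "sampling_rate (crs_tests n ps) n = length ps"
proof -
  have "length (filter (\<lambda>R. i \<in> R) (concat (map (\<lambda>q. map (test_class n q) [0..<q]) qs))) = length qs"
    if "i < n" "0 \<notin> set qs" for i qs
    using that(2)
  proof (induction qs)
    case (Cons q qs)
    then show ?case using length_filter_residue_classes[OF that(1), of q] by simp
  qed simp
  from this[OF _ assms(2)]
  have "(\<lambda>i. length (filter (\<lambda>R. i \<in> R) (crs_tests n ps))) ` {..<n} = {length ps}"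
    using assms(1) by (auto simp: crs_tests_def moduli_def)
  then show ?thesis by (simp add: sampling_rate_def)
qed

section \<open>The analysis program\<close>

definition runs :: "com \<Rightarrow> state \<Rightarrow> nat \<Rightarrow> (state \<Rightarrow> bool) \<Rightarrow> bool" where
  "runs P s B Q \<longleftrightarrow> (\<exists>k s'. exec P s k s' \<and> k \<le> B \<and> Q s')"

lemma runs_mono: "runs P s B Q \<Longrightarrow> B \<le> B' \<Longrightarrow> (\<And>s'. Q s' \<Longrightarrow> Q' s') \<Longrightarrow> runs P s B' Q'"
  unfolding runs_def by (meson order_trans)

lemma runs_atomic:
  "1 \<le> B \<Longrightarrow> Q (r, m) \<Longrightarrow> runs Skip (r, m) B Q"
  "1 \<le> B \<Longrightarrow> Q (r(a := c), m) \<Longrightarrow> runs (Const a c) (r, m) B Q"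
  "1 \<le> B \<Longrightarrow> Q (r(a := r b + r c), m) \<Longrightarrow> runs (Add a b c) (r, m) B Q"
  "1 \<le> B \<Longrightarrow> Q (r(a := m (r b)), m) \<Longrightarrow> runs (Load a b) (r, m) B Q"
  "1 \<le> B \<Longrightarrow> Q (r, m(r a := r b)) \<Longrightarrow> runs (Store a b) (r, m) B Q"
  unfolding runs_def by (blast intro: exec.intros)+

lemma runs_Seq:
  assumes "runs P s B R" "\<And>s'. R s' \<Longrightarrow> runs P' s' B' Q"
  shows "runs (Seq P P') s (B + B') Q"
proof -
  obtain k s' where 1: "exec P s k s'" "k \<le> B" "R s'"
    using assms(1) by (auto simp: runs_def)
  obtain l s'' where 2: "exec P' s' l s''" "l \<le> B'" "Q s''"
    using assms(2)[OF 1(3)] by (auto simp: runs_def)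
  show ?thesis
    unfolding runs_def using exec.Seq[OF 1(1) 2(1)] 1(2) 2(2,3) by (meson add_mono)
qed

lemma runs_Seq':
  assumes "runs P s 1 (\<lambda>s'. runs P' s' (B - 1) Q)" "1 \<le> B"
  shows "runs (Seq P P') s B Q"
  using runs_Seq[OF assms(1), of P' "B - 1" Q] assms(2) by simp

text \<open>Symbolic execution: the leading instruction takes one unit of the budget, and the goal
  moves on to the rest of the program in the updated state.\<close>

lemma runs_Seq_atomic:
  "1 \<le> B \<Longrightarrow> runs P (r, m) (B - 1) Q \<Longrightarrow> runs (Seq Skip P) (r, m) B Q"
  "1 \<le> B \<Longrightarrow> runs P (r(a := c), m) (B - 1) Q \<Longrightarrow> runs (Seq (Const a c) P) (r, m) B Q"
  "1 \<le> B \<Longrightarrow> runs P (r(a := r b + r c), m) (B - 1) Q \<Longrightarrow> runs (Seq (Add a b c) P) (r, m) B Q"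
  "1 \<le> B \<Longrightarrow> runs P (r(a := m (r b)), m) (B - 1) Q \<Longrightarrow> runs (Seq (Load a b) P) (r, m) B Q"
  "1 \<le> B \<Longrightarrow> runs P (r, m(r a := r b)) (B - 1) Q \<Longrightarrow> runs (Seq (Store a b) P) (r, m) B Q"
  by (rule runs_Seq', rule runs_atomic, simp_all)+

text \<open>\<open>exec\<close> charges nothing for sequencing, so the cost is preserved; this
  flattens the branches that \<open>runs_Seq_IfLess\<close> puts in front of the
  continuation.\<close>

lemma runs_Seq_assoc:
  assumes "runs (Seq P (Seq P' P'')) s B Q"
  shows "runs (Seq (Seq P P') P'') s B Q"
proof -
  obtain k s' where 1: "exec (Seq P (Seq P' P'')) s k s'" "k \<le> B" "Q s'"
    using assms by (auto simp: runs_def)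
  from 1(1) have "exec (Seq (Seq P P') P'') s k s'"
  proof cases
    case (Seq k1 s1 l)
    from Seq(3) show ?thesis
    proof cases
      case (Seq k2 s2 l2)
      with exec.Seq[OF exec.Seq[OF \<open>exec P s k1 s1\<close> Seq(2)] Seq(3)] \<open>k = k1 + l\<close>
      show ?thesis by (simp add: add.assoc)
    qed
  qed
  with 1(2,3) show ?thesis unfolding runs_def by blast
qed

text \<open>The continuation \<open>R\<close> is copied into both branches, so no assertion has to
  be found for the point where they meet.\<close>

lemma runs_Seq_IfLess:
  assumes "1 \<le> B"
    and "r a < r b \<Longrightarrow> runs (Seq P R) (r, m) (B - 1) Q"
    and "\<not> r a < r b \<Longrightarrow> runs (Seq P' R) (r, m) (B - 1) Q"
  shows "runs (Seq (IfLess a b P P') R) (r, m) B Q"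
proof -
  have "runs (Seq (IfLess a b P P') R) (r, m) B Q" if less: "r a < r b"
  proof -
    obtain k s' where "exec (Seq P R) (r, m) k s'" and k: "k \<le> B - 1" "Q s'"
      using assms(2)[OF less] by (auto simp: runs_def)
    from this(1) show ?thesis
    proof cases
      case (Seq k1 s1 l)
      have "exec (Seq (IfLess a b P P') R) (r, m) (k1 + 1 + l) s'"
        by (rule exec.Seq[OF exec.IfTrue[OF less Seq(2)] Seq(3)])
      moreover have "k1 + 1 + l \<le> B" using Seq(1) k(1) assms(1) by simp
      ultimately show ?thesis using k(2) unfolding runs_def by blast
    qed
  qed
  moreover have "runs (Seq (IfLess a b P P') R) (r, m) B Q" if less: "\<not> r a < r b"
  proof -
    obtain k s' where "exec (Seq P' R) (r, m) k s'" and k: "k \<le> B - 1" "Q s'"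
      using assms(3)[OF less] by (auto simp: runs_def)
    from this(1) show ?thesis
    proof cases
      case (Seq k1 s1 l)
      have "exec (Seq (IfLess a b P P') R) (r, m) (k1 + 1 + l) s'"
        by (rule exec.Seq[OF exec.IfFalse[OF less Seq(2)] Seq(3)])
      moreover have "k1 + 1 + l \<le> B" using Seq(1) k(1) assms(1) by simp
      ultimately show ?thesis using k(2) unfolding runs_def by blast
    qed
  qed
  ultimately show ?thesis by blast
qed

lemmas runs_intros = runs_atomic runs_Seq_atomic runs_Seq_assoc runs_Seq_IfLess

text \<open>The invariant carries the number of completed iterations. Each iteration costs its body
  and one condition; the final failing condition is the last unit.\<close>

lemma runs_WhileLess:
  assumes step: "\<And>i r m. i < N \<Longrightarrow> I i (r, m) \<Longrightarrow> r a < r b \<and> runs P (r, m) c (I (Suc i))"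
    and exit: "\<And>r m. I N (r, m) \<Longrightarrow> \<not> r a < r b"
    and init: "I 0 s"
  shows "runs (WhileLess a b P) s (N * (c + 1) + 1) (I N)"
proof -
  have "runs (WhileLess a b P) s ((N - i) * (c + 1) + 1) (I N)" if "i \<le> N" "I i s" for i s
    using that
  proof (induction "N - i" arbitrary: i s)
    case 0
    obtain r m where s: "s = (r, m)" by force
    from 0 have "I N (r, m)" by (simp add: s)
    then have "exec (WhileLess a b P) (r, m) 1 (r, m)" by (intro exec.WhileFalse exit)
    with \<open>I N (r, m)\<close> show ?case
      unfolding runs_def s by (intro exI[of _ 1] exI[of _ "(r, m)"]) simp
  next
    case (Suc x)
    obtain r m where s: "s = (r, m)" by force
    from Suc.hyps(2) have "i < N" by simp
    from step[OF this] Suc.prems(2) obtain k s' where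
      1: "r a < r b" "exec P (r, m) k s'" "k \<le> c" "I (Suc i) s'"
      unfolding s runs_def by blast
    obtain l s'' where
      2: "exec (WhileLess a b P) s' l s''" "l \<le> (N - Suc i) * (c + 1) + 1" "I N s''"
    proof -
      have "x = N - Suc i" "Suc i \<le> N" using Suc.hyps(2) by simp_all
      from Suc.hyps(1)[OF this 1(4)] show thesis using that unfolding runs_def by blast
    qed
    have "N - i = Suc (N - Suc i)" using \<open>i < N\<close> by simp
    then have "k + l + 1 \<le> (N - i) * (c + 1) + 1" using 1(3) 2(2) by simp
    with exec.WhileTrue[OF 1(1,2) 2(1)] 2(3) show ?case
      unfolding runs_def s by blast
  qed
  from this[OF _ init] show ?thesis by simp
qed

text \<open>Register 3 holds 1, register 12 holds 0, register 4 the address of the output, register 5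
  the current item \<open>i\<close>, register 7 the index of the current modulus \<open>q\<close> (register 9), register 8 the
  address of its first outcome and register 10 the residue \<open>i mod q\<close>, which is maintained
  incrementally because the machine cannot divide.\<close>

definition scan_step :: com where
  "scan_step =
     Seq (Add 6 8 10) (Seq (Load 11 6)
    (Seq (IfLess 11 3 (Seq (Add 6 4 5) (Store 6 12)) Skip)
    (Seq (Add 10 10 3) (Seq (IfLess 10 9 Skip (Const 10 0)) (Add 5 5 3)))))"

definition scan_modulus :: com where
  "scan_modulus =
     Seq (Load 9 7) (Seq (Const 10 0) (Seq (Const 5 0)
    (Seq (WhileLess 5 0 scan_step) (Seq (Add 8 8 9) (Add 7 7 3)))))"

text \<open>The output is first filled with ones; each modulus then clears the items whose test is
  negative, so the conjunction over the moduli accumulates in place.\<close>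

definition analyser :: com where
  "analyser =
     Seq (Const 3 1) (Seq (Add 4 1 2) (Seq (Const 5 0)
    (Seq (WhileLess 5 0 (Seq (Add 6 4 5) (Seq (Store 6 3) (Add 5 5 3))))
    (Seq (Const 7 0) (Seq (Add 8 1 12) (WhileLess 7 1 scan_modulus))))))"

section \<open>Invariants and cost of the analysis program\<close>

context
  fixes n :: nat and qs :: "nat list" and bs :: "bool list"
  assumes len: "length bs = sum_list qs" and pos: "0 \<notin> set qs"
begin

text \<open>The outcomes come in one block per modulus: the partial sum is the start of block
  \<open>j\<close>, the residue the offset within it.\<close>

definition test_pos :: "nat \<Rightarrow> nat \<Rightarrow> bool" where
  "test_pos j i = bs ! (sum_list (take j qs) + i mod (qs ! j))"

definition input_kept :: "(nat \<Rightarrow> nat) \<Rightarrow> (nat \<Rightarrow> nat) \<Rightarrow> bool" where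
  "input_kept r m \<longleftrightarrow> r 0 = n \<and> r 1 = length qs \<and> r 3 = 1 \<and> r 4 = length qs + length bs \<and> r 12 = 0 \<and>
     (\<forall>a < length qs. m a = qs ! a) \<and> (\<forall>a < length bs. m (length qs + a) = of_bool (bs ! a))"

definition outer_inv :: "nat \<Rightarrow> state \<Rightarrow> bool" where
  "outer_inv j = (\<lambda>(r, m). input_kept r m \<and> r 7 = j \<and> r 8 = length qs + sum_list (take j qs) \<and>
     (\<forall>i<n. m (length qs + length bs + i) = of_bool (\<forall>j'<j. test_pos j' i)))"

definition inner_inv :: "nat \<Rightarrow> nat \<Rightarrow> state \<Rightarrow> bool" where
  "inner_inv j i = (\<lambda>(r, m). input_kept r m \<and> r 7 = j \<and> r 8 = length qs + sum_list (take j qs) \<and>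
     r 9 = qs ! j \<and> r 5 = i \<and> r 10 = i mod (qs ! j) \<and>
     (\<forall>i'<n. m (length qs + length bs + i') =
        of_bool (\<forall>j' < (if i' < i then Suc j else j). test_pos j' i')))"

text \<open>Keeps the address read by the scan among the outcomes, where \<open>input_kept\<close>
  fixes the memory.\<close>

lemma outcome_index:
  assumes "j < length qs" "x < qs ! j"
  shows "sum_list (take j qs) + x < length bs"
proof -
  have "sum_list (take (Suc j) qs) \<le> sum_list qs"
    by (metis append_take_drop_id le_add1 sum_list_append)
  with assms show ?thesis by (simp add: len take_Suc_conv_app_nth)
qed

lemma runs_scan_step:
  assumes j: "j < length qs" and i: "i < n" and inv: "inner_inv j i (r, m)"
  shows "runs scan_step (r, m) 10 (inner_inv j (Suc i))"
proof -
  define q where "q = qs ! j"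
  have q: "q > 0" using pos j nth_mem[OF j] unfolding q_def by (cases "qs ! j") auto
  then have idx: "sum_list (take j qs) + i mod q < length bs"
    using outcome_index[OF j, of "i mod q"] by (simp add: q_def)
  have outcome: "m (length qs + (sum_list (take j qs) + i mod q)) = of_bool (test_pos j i)"
    using inv idx by (simp add: inner_inv_def input_kept_def test_pos_def q_def)
  \<comment> \<open>The wrap-around that the program performs by comparing register 10 with register
    9.\<close>
  have residue: "Suc i mod q = (if Suc (i mod q) < q then Suc (i mod q) else 0)"
    using q by (simp add: mod_Suc) (metis Suc_lessI mod_less_divisor)
  have split: "(\<forall>j'<Suc j. P j') \<longleftrightarrow> (\<forall>j'<j. P j') \<and> P j" for P
    by (auto simp: less_Suc_eq)
  show ?thesis
    unfolding scan_step_def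
    apply (intro runs_intros)
    using inv outcome
    apply (simp_all add: inner_inv_def input_kept_def residue split less_Suc_eq add.assoc flip: q_def)
    apply (auto simp: less_Suc_eq)
    done
qed

lemma runs_scan_modulus:
  assumes j: "j < length qs" and inv: "outer_inv j (r, m)"
  shows "runs scan_modulus (r, m) (n * 11 + 6) (outer_inv (Suc j))"
proof -
  define r' where "r' = r(9 := m (r 7), 10 := 0, 5 := 0)"
  have "inner_inv j 0 (r', m)"
    using inv j by (simp add: outer_inv_def inner_inv_def input_kept_def r'_def)
  then have loop: "runs (WhileLess 5 0 scan_step) (r', m) (n * (10 + 1) + 1) (inner_inv j n)"
  proof (rule runs_WhileLess[rotated 2])
    fix i r m assume "i < n" "inner_inv j i (r, m)"
    then show "r 5 < r 0 \<and> runs scan_step (r, m) 10 (inner_inv j (Suc i))"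
      by (intro conjI runs_scan_step[OF j]) (simp_all add: inner_inv_def input_kept_def)
  next
    fix r m assume "inner_inv j n (r, m)"
    then show "\<not> r 5 < r 0" by (simp add: inner_inv_def input_kept_def)
  qed
  have tail: "runs (Seq (Add 8 8 9) (Add 7 7 3)) s' 2 (outer_inv (Suc j))"
    if "inner_inv j n s'" for s'
  proof -
    obtain r1 m1 where s': "s' = (r1, m1)" by force
    show ?thesis
      unfolding s'
      apply (intro runs_intros)
      using that j
      apply (simp_all add: s' inner_inv_def outer_inv_def input_kept_def take_Suc_conv_app_nth)
      done
  qed
  have "runs (Seq (WhileLess 5 0 scan_step) (Seq (Add 8 8 9) (Add 7 7 3))) (r', m) (3 + n * 11)
      (outer_inv (Suc j))"
    by (rule runs_mono[OF runs_Seq[OF loop tail]]) simp_all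
  then show ?thesis
    unfolding scan_modulus_def by (intro runs_intros) (simp_all add: r'_def)
qed

lemma runs_analyser:
  "runs analyser (analysis_input n qs bs) (n * 4 + length qs * (n * 11 + 7) + 8)
     (outer_inv (length qs))"
proof -
  obtain r m where input: "analysis_input n qs bs = (r, m)" by force
  define r1 where "r1 = r(3 := 1, 4 := r 1 + r 2, 5 := 0)"
  define I where "I = (\<lambda>i (r, m). input_kept r m \<and> r 5 = i \<and>
    (\<forall>i'<i. m (length qs + length bs + i') = 1))"
  have "I 0 (r1, m)"
    using input by (auto simp: I_def analysis_input_def input_kept_def r1_def Let_def nth_append)
  then have init: "runs (WhileLess 5 0 (Seq (Add 6 4 5) (Seq (Store 6 3) (Add 5 5 3)))) (r1, m)
      (n * (3 + 1) + 1) (I n)"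
  proof (rule runs_WhileLess[rotated 2])
    fix i r m assume "i < n" and inv: "I i (r, m)"
    have "runs (Seq (Add 6 4 5) (Seq (Store 6 3) (Add 5 5 3))) (r, m) 3 (I (Suc i))"
      apply (intro runs_intros)
      using inv
      apply (auto simp add: I_def input_kept_def less_Suc_eq)
      done
    with \<open>i < n\<close> inv
    show "r 5 < r 0 \<and> runs (Seq (Add 6 4 5) (Seq (Store 6 3) (Add 5 5 3))) (r, m) 3 (I (Suc i))"
      by (simp add: I_def input_kept_def)
  next
    fix r m assume "I n (r, m)"
    then show "\<not> r 5 < r 0" by (simp add: I_def input_kept_def)
  qed
  have main: "runs (WhileLess 7 1 scan_modulus) s (length qs * (n * 11 + 6 + 1) + 1)
      (outer_inv (length qs))" if "outer_inv 0 s" for s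
    using that
  proof (rule runs_WhileLess[rotated 2])
    fix j r m assume "j < length qs" "outer_inv j (r, m)"
    then show "r 7 < r 1 \<and> runs scan_modulus (r, m) (n * 11 + 6) (outer_inv (Suc j))"
      by (intro conjI runs_scan_modulus) (simp_all add: outer_inv_def input_kept_def)
  next
    fix r m assume "outer_inv (length qs) (r, m)"
    then show "\<not> r 7 < r 1" by (simp add: outer_inv_def input_kept_def)
  qed
  have rest: "runs (Seq (Const 7 0) (Seq (Add 8 1 12) (WhileLess 7 1 scan_modulus))) s
      (2 + (length qs * (n * 11 + 7) + 1)) (outer_inv (length qs))" if "I n s" for s
  proof -
    obtain r2 m2 where s: "s = (r2, m2)" by force
    have "outer_inv 0 (r2(7 := 0, 8 := r2 1 + r2 12), m2)"
      using that by (simp add: s I_def outer_inv_def input_kept_def)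
    from main[OF this] show ?thesis
      unfolding s by (intro runs_intros) (simp_all add: algebra_simps)
  qed
  have "runs (Seq (WhileLess 5 0 (Seq (Add 6 4 5) (Seq (Store 6 3) (Add 5 5 3))))
      (Seq (Const 7 0) (Seq (Add 8 1 12) (WhileLess 7 1 scan_modulus)))) (r1, m)
      (5 + (n * 4 + length qs * (n * 11 + 7))) (outer_inv (length qs))"
    by (rule runs_mono[OF runs_Seq[OF init rest]]) (simp_all add: algebra_simps)
  then show ?thesis
    unfolding analyser_def input
    by (intro runs_intros) (simp_all add: r1_def)
qed

end

lemma nth_concat_map_upt:
  assumes "j < length qs" "x < qs ! j"
  shows "concat (map (\<lambda>q. map (f q) [0..<q]) qs) ! (sum_list (take j qs) + x) = f (qs ! j) x"
  using assms
proof (induction qs arbitrary: j)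
  case (Cons q qs)
  then show ?case by (cases j) (auto simp: nth_append add.assoc)
qed simp

lemma analyses_within_analyser:
  assumes crs: "crs_sequence n d ps" and n: "2 \<le> n" and d: "1 \<le> d"
  shows "analyses_within analyser n d ps (30 * (n * length (crs_tests n ps)))"
  unfolding analyses_within_def Let_def
proof
  fix D assume D: "D \<in> defective_sets n d"
  define qs where "qs = moduli ps"
  define bs where "bs = outcomes (crs_tests n ps) D"
  have pos: "0 \<notin> set qs"
    using crs by (auto simp: qs_def moduli_def crs_sequence_def)
  have tests: "length (crs_tests n ps) = sum_list qs"
    by (simp add: crs_tests_def qs_def length_concat comp_def)
  then have len: "length bs = sum_list qs"
    by (simp add: bs_def outcomes_def)
  from runs_analyser[OF len pos, of n] obtain k s where ks:
    "exec analyser (analysis_input n qs bs) k s"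
    "k \<le> n * 4 + length qs * (n * 11 + 7) + 8" "outer_inv n qs bs (length qs) s"
    by (auto simp: runs_def)
  have positive: "test_pos qs bs j i \<longleftrightarrow> test_class n (qs ! j) (i mod (qs ! j)) \<inter> D \<noteq> {}"
    if j: "j < length qs" for j i
  proof -
    have "qs ! j > 0" using pos nth_mem[OF j] by (cases "qs ! j") auto
    then have x: "i mod (qs ! j) < qs ! j" by simp
    then show ?thesis
      unfolding test_pos_def[OF len pos]
      using nth_concat_map_upt[OF j x, of "test_class n"] outcome_index[OF len pos j x]
      by (simp add: bs_def outcomes_def crs_tests_def flip: qs_def)
  qed
  have "analysis_output n qs bs D s"
    unfolding analysis_output_def
  proof (intro allI impI)
    fix i assume i: "i < n"
    have "(\<forall>j<length qs. test_pos qs bs j i) \<longleftrightarrow> passes_all n ps D i"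
      unfolding passes_all_def qs_def[symmetric] by (auto simp: positive all_set_conv_all_nth)
    also have "\<dots> \<longleftrightarrow> i \<in> D" using mem_defective_iff[OF crs n d D i] by simp
    finally show "snd s (length qs + length bs + i) = of_bool (i \<in> D)"
      using ks(3) i by (auto simp: outer_inv_def[OF len pos])
  qed
  moreover have "k \<le> 30 * (n * length (crs_tests n ps))"
  proof -
    have "length qs \<le> sum_list qs"
      using pos by (induction qs) (auto simp: Suc_le_eq)
    moreover have "qs \<noteq> []"
    proof
      assume "qs = []"
      then have "n ^ d \<le> 1" using crs by (simp add: qs_def crs_sequence_def)
      then show False using one_less_power[of n d] n d by simp
    qed
    ultimately have "1 \<le> sum_list qs" by (cases qs) auto
    have "length qs * (n * 11 + 7) \<le> sum_list qs * (n * 11 + 7)"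
      using \<open>length qs \<le> sum_list qs\<close> by (rule mult_right_mono) simp
    also have "\<dots> = 11 * (sum_list qs * n) + 7 * sum_list qs" by (simp add: algebra_simps)
    finally have "length qs * (n * 11 + 7) \<le> 11 * (sum_list qs * n) + 7 * sum_list qs" .
    \<comment> \<open>All four terms of the step count become multiples of
      \<open>sum_list qs * n\<close>, with factors 4, 11, 7 and 8; these add up to the constant
      30.\<close>
    moreover have "sum_list qs \<le> sum_list qs * n" "n \<le> sum_list qs * n" "1 \<le> sum_list qs * n"
      using n \<open>1 \<le> sum_list qs\<close> by simp_all
    ultimately have "k \<le> 30 * (sum_list qs * n)"
      using ks(2) by linarith
    then show ?thesis by (simp add: tests mult.commute)
  qed
  ultimately show "\<exists>k s. exec analyser (analysis_input n (moduli ps) (outcomes (crs_tests n ps) D)) k s \<and>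
      analysis_output n (moduli ps) (outcomes (crs_tests n ps) D) D s \<and>
      k \<le> 30 * (n * length (crs_tests n ps))"
    using ks(1) unfolding qs_def bs_def by blast
qed

section \<open>Chebyshev's estimates\<close>

lemma ln_2_bounds: "0.693147 \<le> ln (2::real)" "ln (2::real) \<le> 0.693148"
  using ln_approx_bounds[of 2 6] by (simp_all add: eval_nat_numeral)

lemma ln_3_bounds: "1.0986 \<le> ln (3::real)" "ln (3::real) \<le> 1.09862"
proof -
  have "ln (3::real) = ln 2 + ln (3 / 2)" by (simp add: ln_div)
  then show "1.0986 \<le> ln (3::real)" "ln (3::real) \<le> 1.09862"
    using ln_approx_bounds[of "3 / 2" 4] ln_2_bounds by (simp_all add: eval_nat_numeral)
qed

lemma ln_5_bounds: "1.6094 \<le> ln (5::real)" "ln (5::real) \<le> 1.60944"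
proof -
  have "ln (5::real) = ln (4 * (5 / 4))" by simp
  also have "\<dots> = ln (2\<^sup>2) + ln (5 / 4)" by (subst ln_mult) simp_all
  also have "\<dots> = 2 * ln 2 + ln (5 / 4)" by (subst ln_realpow) simp_all
  finally show "1.6094 \<le> ln (5::real)" "ln (5::real) \<le> 1.60944"
    using ln_approx_bounds[of "5 / 4" 3] ln_2_bounds by (simp_all add: eval_nat_numeral)
qed

text \<open>Chebyshev's second function, the logarithm of the least common multiple of
  \<open>1, ..., n\<close>.\<close>

definition psi :: "nat \<Rightarrow> real" where
  "psi n = (\<Sum>d = 1..n. mangoldt d)"

text \<open>\<open>ln k\<close> is the sum of the Mangoldt function over the divisors of
  \<open>k\<close>, and \<open>d\<close> has \<open>n div d\<close> multiples up to
  \<open>n\<close>. The range up to \<open>N\<close> adds only zeros and lets different factorials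
  be combined termwise.\<close>

lemma ln_fact_eq_sum_mangoldt:
  assumes "n \<le> N"
  shows "ln (fact n) = (\<Sum>d = 1..N. mangoldt d * real (n div d))"
  using assms
proof (induction n)
  case (Suc n)
  have "ln (fact (Suc n)) = ln (real (Suc n)) + ln (fact n :: real)"
    by (simp add: ln_mult del: of_nat_Suc)
  also have "ln (real (Suc n)) = (\<Sum>d | d dvd Suc n. mangoldt d)"
    using mangoldt_sum[of "Suc n", where ?'a = real] by simp
  also have "\<dots> = (\<Sum>d = 1..N. if d dvd Suc n then mangoldt d else 0)"
  proof (intro sum.mono_neutral_cong_left)
    show "{d. d dvd Suc n} \<subseteq> {1..N}"
    proof
      fix d assume "d \<in> {d. d dvd Suc n}"
      then have "d dvd Suc n" by simp
      then have "d \<le> Suc n" "d > 0" using dvd_pos_nat[of "Suc n" d] by (auto dest: dvd_imp_le)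
      then show "d \<in> {1..N}" using Suc.prems by simp
    qed
  qed auto
  also have "ln (fact n) = (\<Sum>d = 1..N. mangoldt d * real (n div d))"
    using Suc by simp
  finally show ?case
    by (simp add: sum.distrib[symmetric] div_Suc dvd_eq_mod_eq_0 algebra_simps del: of_nat_Suc)
       (intro sum.cong refl, simp add: algebra_simps)
qed simp

text \<open>Chebyshev's combination: its coefficients on the Mangoldt function depend only on
  \<open>n div d\<close> modulo 30 and lie between 0 and 1.\<close>

definition chebyshev_sum :: "nat \<Rightarrow> real" where
  "chebyshev_sum n = ln (fact n) - ln (fact (n div 2)) - ln (fact (n div 3)) - ln (fact (n div 5)) +
     ln (fact (n div 30))"

definition chebyshev_coeff :: "nat \<Rightarrow> real" where
  "chebyshev_coeff m = real m - real (m div 2) - real (m div 3) - real (m div 5) + real (m div 30)"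

lemma chebyshev_sum_eq:
  "chebyshev_sum n = (\<Sum>d = 1..n. mangoldt d * chebyshev_coeff (n div d))"
proof -
  have "ln (fact (n div k)) = (\<Sum>d = 1..n. mangoldt d * real (n div d div k))" for k
    using ln_fact_eq_sum_mangoldt[of "n div k" n] by (simp add: div_mult2_eq[symmetric] mult.commute)
  from this[of 2] this[of 3] this[of 5] this[of 30] show ?thesis
    unfolding chebyshev_sum_def chebyshev_coeff_def
    by (simp add: ln_fact_eq_sum_mangoldt[of n n] algebra_simps sum.distrib sum_subtractf)
qed

lemma chebyshev_coeff_bounds:
  "0 \<le> chebyshev_coeff m" "chebyshev_coeff m \<le> 1"
  "1 \<le> m \<Longrightarrow> m < 6 \<Longrightarrow> chebyshev_coeff m = 1"
proof -
  define q r where "q = m div 30" and "r = m mod 30"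
  have m: "m = 30 * q + r" "r < 30" by (simp_all add: q_def r_def)
  have "m div 2 = 15 * q + r div 2" "m div 3 = 10 * q + r div 3" "m div 5 = 6 * q + r div 5"
    by (simp_all add: m(1))
  moreover have "m div 30 = q" by (simp add: q_def)
  \<comment> \<open>The multiples of \<open>q\<close> cancel because
    \<open>30 - 15 - 10 - 6 + 1 = 0\<close>, which leaves 30 residues to inspect.\<close>
  ultimately have c: "chebyshev_coeff m = real r - real (r div 2) - real (r div 3) - real (r div 5)"
    by (simp add: chebyshev_coeff_def m(1))
  have "\<forall>r\<in>set [0..<30]. r div 2 + r div 3 + r div 5 \<le> r \<and> r \<le> r div 2 + r div 3 + r div 5 + (1::nat)"
    by code_simp
  then have *: "r div 2 + r div 3 + r div 5 \<le> r" "r \<le> r div 2 + r div 3 + r div 5 + (1::nat)"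
    using m(2) by auto
  show "0 \<le> chebyshev_coeff m" unfolding c using *(1) by linarith
  show "chebyshev_coeff m \<le> 1" unfolding c using *(2) by linarith
  show "chebyshev_coeff m = 1" if "1 \<le> m" "m < 6"
  proof -
    have "m \<in> {1, 2, 3, 4, 5}" using that by auto
    then show ?thesis by (auto simp: chebyshev_coeff_def)
  qed
qed

lemma chebyshev_sum_le_psi: "chebyshev_sum n \<le> psi n"
  unfolding chebyshev_sum_eq psi_def
  by (intro sum_mono mult_left_le chebyshev_coeff_bounds mangoldt_nonneg)

text \<open>For \<open>n div 6 < d \<le> n\<close> the quotient \<open>n div d\<close> is between 1
  and 5, where the coefficient is 1; the other terms are nonnegative.\<close>

lemma psi_diff_le_chebyshev_sum: "psi n - psi (n div 6) \<le> chebyshev_sum n"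
proof -
  have "psi n = (\<Sum>d\<in>{1..n} - {1..n div 6}. mangoldt d) + psi (n div 6)"
    unfolding psi_def by (rule sum.subset_diff) (auto intro: order_trans)
  then have "psi n - psi (n div 6) = (\<Sum>d\<in>{1..n} - {1..n div 6}. mangoldt d)" by simp
  also have "\<dots> = (\<Sum>d\<in>{1..n} - {1..n div 6}. mangoldt d * chebyshev_coeff (n div d))"
  proof (intro sum.cong refl)
    fix d assume "d \<in> {1..n} - {1..n div 6}"
    then have d: "1 \<le> d" "d \<le> n" "n div 6 < d" by auto
    then have "n div d < 6" by (simp add: less_mult_imp_div_less div_less_iff_less_mult mult.commute)
    moreover have "1 \<le> n div d" using d by (simp add: Suc_le_eq div_greater_zero_iff)
    ultimately show "(mangoldt d :: real) = mangoldt d * chebyshev_coeff (n div d)"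
      by (simp add: chebyshev_coeff_bounds)
  qed
  also have "\<dots> \<le> (\<Sum>d = 1..n. mangoldt d * chebyshev_coeff (n div d))"
    by (intro sum_mono2) (auto intro!: mult_nonneg_nonneg mangoldt_nonneg chebyshev_coeff_bounds)
  finally show ?thesis by (simp add: chebyshev_sum_eq)
qed

section \<open>Stirling bounds for factorials\<close>

definition stirling_main :: "real \<Rightarrow> real" where
  "stirling_main x = x * ln x - x + 1"

text \<open>\<open>stirling_main x\<close> is the integral of \<open>ln\<close> from 1 to
  \<open>x\<close>, so these are mean value bounds; both follow from
  \<open>ln z \<le> z - 1\<close>, taken at \<open>x / y\<close> and \<open>y / x\<close>.\<close>

lemma stirling_main_diff:
  assumes "0 < y" "y \<le> x"
  shows "(x - y) * ln y \<le> stirling_main x - stirling_main y"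
    and "stirling_main x - stirling_main y \<le> (x - y) * ln x"
proof -
  have l: "ln (x / y) = ln x - ln y" using assms by (simp add: ln_div)
  have "y * ln (x / y) \<le> y * (x / y - 1)"
    using assms by (intro mult_left_mono ln_le_minus_one) auto
  then have "y * (ln x - ln y) \<le> x - y" using assms by (simp add: l algebra_simps)
  then show "stirling_main x - stirling_main y \<le> (x - y) * ln x"
    by (simp add: stirling_main_def algebra_simps)
  have "ln (y / x) = ln y - ln x" using assms by (simp add: ln_div)
  moreover have "x * ln (y / x) \<le> x * (y / x - 1)"
    using assms by (intro mult_left_mono ln_le_minus_one) auto
  moreover have "x * (y / x - 1) = y - x" using assms by (simp add: field_simps)
  ultimately have "x * (ln y - ln x) \<le> y - x" by simp
  then show "(x - y) * ln y \<le> stirling_main x - stirling_main y"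
    by (simp add: stirling_main_def algebra_simps)
qed

text \<open>From \<open>n\<close> to \<open>n + 1\<close> the factorial gains
  \<open>ln (n + 1)\<close> and the integral between \<open>ln n\<close> and
  \<open>ln (n + 1)\<close>; the gaps telescope to at most \<open>ln n\<close>.\<close>

lemma ln_fact_bounds_nat:
  assumes "1 \<le> n"
  shows "stirling_main (real n) \<le> ln (fact n) \<and> ln (fact n) \<le> stirling_main (real n) + ln (real n)"
  using assms
proof (induction n rule: dec_induct)
  case base
  then show ?case by (simp add: stirling_main_def)
next
  case (step n)
  have f: "ln (fact (Suc n)) = ln (real (Suc n)) + ln (fact n :: real)"
    by (simp add: ln_mult del: of_nat_Suc)
  have "stirling_main (real (Suc n)) - stirling_main (real n) \<le> ln (real (Suc n))"
       "ln (real n) \<le> stirling_main (real (Suc n)) - stirling_main (real n)"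
    using stirling_main_diff[of "real n" "real (Suc n)"] step by simp_all
  then show ?case using step.IH f by linarith
qed

text \<open>Passes to real arguments, because the main terms of the combination cancel at the exact
  quotients \<open>n / k\<close>.\<close>

lemma ln_fact_bounds:
  assumes "1 \<le> n" "real n \<le> x" "x \<le> real n + 1"
  shows "stirling_main x - ln x \<le> ln (fact n)" "ln (fact n) \<le> stirling_main x + ln x"
proof -
  note d = stirling_main_diff[of "real n" x]
  have "(x - n) * ln x \<le> 1 * ln x" using assms by (intro mult_right_mono) auto
  then show "stirling_main x - ln x \<le> ln (fact n)"
    using d(2) assms ln_fact_bounds_nat[OF assms(1)] by auto
  have "0 \<le> (x - n) * ln n" "ln n \<le> ln x" using assms by (auto intro!: mult_nonneg_nonneg)
  then show "ln (fact n) \<le> stirling_main x + ln x"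
    using d(1)[OF _ assms(2)] assms(1) ln_fact_bounds_nat[OF assms(1)] by linarith
qed

lemma ln_fact_div_bounds:
  assumes "0 < k" "k \<le> n"
  shows "stirling_main (n / k) - (ln n - ln k) \<le> ln (fact (n div k))"
    "ln (fact (n div k)) \<le> stirling_main (n / k) + (ln n - ln k)"
proof -
  have "1 \<le> n div k" using assms by (simp add: Suc_le_eq div_greater_zero_iff)
  moreover have "real (n div k) \<le> n / k" by (rule of_nat_div_le_of_nat)
  moreover have "n / k \<le> real (n div k) + 1"
  proof -
    have "n \<le> (n div k + 1) * k"
      using dividend_less_div_times[of k n] assms(1) by simp
    then have "real n \<le> (real (n div k) + 1) * real k"
      by (simp only: of_nat_le_iff[symmetric, where ?'a = real] of_nat_mult of_nat_add of_nat_1)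
    then show ?thesis using assms(1) by (simp add: divide_le_eq)
  qed
  moreover have "ln (n / k) = ln n - ln k" using assms by (simp add: ln_div)
  ultimately show "stirling_main (n / k) - (ln n - ln k) \<le> ln (fact (n div k))"
    "ln (fact (n div k)) \<le> stirling_main (n / k) + (ln n - ln k)"
    using ln_fact_bounds[of "n div k" "n / k"] by simp_all
qed

lemma ln_30: "ln (30::real) = ln 2 + ln 3 + ln 5"
  using ln_mult[of 2 "15 :: real"] ln_mult[of 3 "5 :: real"] by simp

text \<open>The first factorial errs in one direction only, hence 4 logarithms below and 5 above;
  5.8 and -7.8 round \<open>2 * ln 30 - 1\<close> and \<open>- 2 * ln 30 - 1\<close>.\<close>

lemma chebyshev_sum_bounds:
  assumes "30 \<le> n"
  shows "0.9212 * real n - 4 * ln n + 5.8 \<le> chebyshev_sum n"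
    "chebyshev_sum n \<le> 0.9213 * real n + 5 * ln n - 7.8"
proof -
  \<comment> \<open>Chebyshev's constant
    \<open>ln 2 / 2 + ln 3 / 3 + ln 5 / 5 - ln 30 / 30\<close>.\<close>
  define A where "A = (14 * ln 2 + 9 * ln 3 + 5 * ln 5) / (30::real)"
  have A: "0.9212 \<le> A" "A \<le> 0.9213"
    unfolding A_def using ln_2_bounds ln_3_bounds ln_5_bounds by simp_all
  define B where "B = A * real n"
  have An: "0.9212 * real n \<le> B" "B \<le> 0.9213 * n"
    unfolding B_def using A by (intro mult_right_mono; simp)+
  have l: "ln (n / k) = ln n - ln k" if "k > 0" for k :: real
    using that assms by (simp add: ln_div)
  \<comment> \<open>As \<open>1 - 1/2 - 1/3 - 1/5 + 1/30 = 0\<close>, the terms in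
    \<open>n * ln n\<close> and \<open>- n\<close> cancel.\<close>
  have main: "stirling_main n - stirling_main (n / 2) - stirling_main (n / 3) - stirling_main (n / 5) +
      stirling_main (n / 30) = B - 1"
    unfolding stirling_main_def B_def A_def by (simp add: l ln_30 field_simps)
  note bounds = ln_fact_div_bounds[of 2 n] ln_fact_div_bounds[of 3 n] ln_fact_div_bounds[of 5 n]
    ln_fact_div_bounds[of 30 n]
  have n: "stirling_main n \<le> ln (fact n)" "ln (fact n) \<le> stirling_main n + ln n"
    using ln_fact_bounds_nat[of n] assms by auto
  show "0.9212 * real n - 4 * ln n + 5.8 \<le> chebyshev_sum n"
    using main bounds n An(1) assms ln_30 ln_2_bounds ln_3_bounds ln_5_bounds
    unfolding chebyshev_sum_def by simp
  show "chebyshev_sum n \<le> 0.9213 * real n + 5 * ln n - 7.8"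
    using main bounds n An(2) assms ln_30 ln_2_bounds ln_3_bounds ln_5_bounds
    unfolding chebyshev_sum_def by simp
qed

lemma psi_ge: "30 \<le> n \<Longrightarrow> 0.9212 * real n - 4 * ln n + 5.8 \<le> psi n"
  using chebyshev_sum_bounds(1) chebyshev_sum_le_psi by (rule order_trans)

text \<open>Two rounds of the recursion exhaust \<open>n < 30\<close>; the resulting quotient of
  factorials is compared with a power of 2, and \<open>8/5 * ln 2 < 1.11\<close>.\<close>

lemma psi_small:
  assumes "n < 30"
  shows "psi n \<le> 1.11 * real n"
proof -
  define f :: "nat \<Rightarrow> nat" where "f n = fact (n div 2) * fact (n div 3) * fact (n div 5)" for n
  have U: "chebyshev_sum n = ln (real (fact n)) - ln (real (f n))" if "n < 30" for n
    using that by (simp add: chebyshev_sum_def f_def ln_mult)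
  have "n div 6 div 6 = 0" using assms by simp
  then have "psi n \<le> chebyshev_sum n + chebyshev_sum (n div 6)"
    using psi_diff_le_chebyshev_sum[of n] psi_diff_le_chebyshev_sum[of "n div 6"]
    by (simp add: psi_def)
  also have "\<dots> = ln (real (fact n * fact (n div 6))) - ln (real (f n * f (n div 6)))"
    using assms by (simp add: U ln_mult f_def)
  also have "\<dots> \<le> real (8 * n div 5) * ln 2"
  proof -
    have "\<forall>n\<in>{0..<30}. fact n * fact (n div 6) \<le>
        2 ^ (8 * n div 5) * (fact (n div 2) * fact (n div 3) * fact (n div 5) *
        (fact (n div 6 div 2) * fact (n div 6 div 3) * fact (n div 6 div 5) :: nat))"
      by (simp add: atLeastLessThan_nat_numeral fact_numeral)
    then have "fact n * fact (n div 6) \<le> 2 ^ (8 * n div 5) * (f n * f (n div 6))"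
      using assms by (simp add: f_def)
    then have "real (fact n * fact (n div 6)) \<le> real (2 ^ (8 * n div 5) * (f n * f (n div 6)))"
      by (simp only: of_nat_le_iff)
    then have "ln (real (fact n * fact (n div 6))) \<le> ln (real (2 ^ (8 * n div 5) * (f n * f (n div 6))))"
      by (subst ln_le_cancel_iff) (simp_all add: f_def)
    also have "\<dots> = real (8 * n div 5) * ln 2 + ln (real (f n * f (n div 6)))"
      by (simp add: ln_mult ln_realpow f_def)
    finally show ?thesis by simp
  qed
  also have "\<dots> \<le> (8 * n / 5) * 0.69315"
    using of_nat_div_le_of_nat[of "8 * n" 5, where ?'a = real] ln_2_bounds by (intro mult_mono) simp_all
  also have "\<dots> \<le> 1.11 * real n" by simp
  finally show ?thesis .
qed

text \<open>The summand \<open>1.4 (ln n)\<^sup>2\<close> absorbs the logarithmic errors of the recursion from \<open>n\<close> to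
  \<open>n div 6\<close>.\<close>

lemma psi_le: "1 \<le> n \<Longrightarrow> psi n \<le> 1.11 * real n + 1.4 * (ln n)\<^sup>2"
proof (induction n rule: less_induct)
  case (less n)
  show ?case
  proof (cases "n < 30")
    case True
    from psi_small[OF this] show ?thesis by (rule order_trans) simp
  next
    case False
    then have n: "30 \<le> n" by simp
    define l where "l = ln (real n)"
    have ln6: "1.7916 \<le> ln (6::real)" "ln (6::real) \<le> 1.7919"
    proof -
      have "ln (6::real) = ln (2 * 3)" by simp
      also have "\<dots> = ln 2 + ln 3" by (subst ln_mult) simp_all
      finally show "1.7916 \<le> ln (6::real)" "ln (6::real) \<le> 1.7919"
        using ln_2_bounds ln_3_bounds by simp_all
    qed
    have pos: "1 \<le> n div 6" using n by simp
    have "psi (n div 6) \<le> 1.11 * real (n div 6) + 1.4 * (ln (n div 6))\<^sup>2"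
      using pos n by (intro less) auto
    moreover have "real (n div 6) \<le> n / 6"
      using of_nat_div_le_of_nat[of n 6, where ?'a = real] by simp
    moreover have "(ln (real (n div 6)))\<^sup>2 \<le> (l - ln 6)\<^sup>2"
    proof (rule power_mono)
      have "ln (real (n div 6)) \<le> ln (n / 6)"
        using pos of_nat_div_le_of_nat[of n 6, where ?'a = real] by (subst ln_le_cancel_iff) auto
      then show "ln (real (n div 6)) \<le> l - ln 6" using n by (simp add: ln_div l_def)
      show "0 \<le> ln (real (n div 6))" using pos by (intro ln_ge_zero) linarith
    qed
    ultimately have "psi (n div 6) \<le> 1.11 * (n / 6) + 1.4 * (l - ln 6)\<^sup>2" by simp
    moreover have "psi n - psi (n div 6) \<le> 0.9213 * n + 5 * l - 7.8"
      using psi_diff_le_chebyshev_sum[of n] chebyshev_sum_bounds(2)[OF n] by (simp add: l_def)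
    \<comment> \<open>Since \<open>2.8 * ln 6 > 5\<close>, the cross term of the square pays for the
      error \<open>5 * l\<close>. The linear terms close because
      \<open>1.11 / 6 + 0.9213 < 1.11\<close>.\<close>
    moreover have "1.4 * (l - ln 6)\<^sup>2 \<le> 1.4 * l\<^sup>2 - 5 * l + 4.5"
    proof -
      have "0 \<le> l" using n by (simp add: l_def)
      define c where "c = ln 6 * l"
      have "1.7916 * l \<le> c" unfolding c_def using ln6 \<open>0 \<le> l\<close> by (intro mult_right_mono)
      moreover have "(ln (6::real))\<^sup>2 \<le> 3.211"
        using power_mono[of "ln (6::real)" "1.7919" 2] ln6 by (simp add: power2_eq_square)
      moreover have "1.4 * (l - ln 6)\<^sup>2 = 1.4 * l\<^sup>2 - 2.8 * c + 1.4 * (ln 6)\<^sup>2"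
        by (simp add: power2_eq_square algebra_simps c_def)
      ultimately show ?thesis using \<open>0 \<le> l\<close> by simp
    qed
    ultimately show ?thesis unfolding l_def by simp
  qed
qed

section \<open>Prime powers for large parameters\<close>

text \<open>The claimed sampling bound; the claimed bound on the tests is \<open>L * rate L\<close>,
  so fewer than \<open>rate L\<close> moduli of size at most \<open>L\<close> satisfy both.\<close>

definition rate :: "real \<Rightarrow> real" where
  "rate L = L / (2 * ln L) * (1 + 1.2762 / ln L)"

definition good_sequence :: "real \<Rightarrow> nat \<Rightarrow> (nat \<times> nat) list \<Rightarrow> bool" where
  "good_sequence L m ps \<longleftrightarrow>
     (\<forall>(p, e) \<in> set ps. prime p \<and> e \<ge> 1) \<and> distinct (map fst ps) \<and> m \<le> prod_list (moduli ps) \<and>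
     real (length ps) < rate L \<and> real (sum_list (moduli ps)) < L * rate L"

definition top_exp :: "nat \<Rightarrow> nat \<Rightarrow> nat" where
  "top_exp N p = Max {e. p ^ e \<le> N}"

lemma finite_exponents:
  assumes "2 \<le> p"
  shows "finite {e. p ^ e \<le> (N :: nat)}"
proof (rule finite_subset)
  show "{e. p ^ e \<le> N} \<subseteq> {..N}"
    using self_le_ge2_pow[OF assms] order_trans by auto
qed simp

lemma top_exp:
  assumes "2 \<le> p" "1 \<le> N"
  shows "p ^ top_exp N p \<le> N" and "p ^ e \<le> N \<Longrightarrow> e \<le> top_exp N p"
proof -
  have "0 \<in> {e. p ^ e \<le> N}" using assms by simp
  then have "top_exp N p \<in> {e. p ^ e \<le> N}"
    unfolding top_exp_def using finite_exponents[OF assms(1)] \<open>0 \<in> _\<close> by (intro Max_in) blast+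
  then show "p ^ top_exp N p \<le> N" by simp
  show "p ^ e \<le> N \<Longrightarrow> e \<le> top_exp N p"
    unfolding top_exp_def using finite_exponents[OF assms(1)] by (intro Max_ge) auto
qed

text \<open>Each prime power in \<open>(M, N]\<close> contributes the logarithm of its prime. A
  prime has at most \<open>top_exp N p\<close> of them, and none unless its largest power up to
  \<open>N\<close> exceeds \<open>M\<close>; that power as a modulus accounts for all of
  them.\<close>

lemma psi_diff_le_top_exp:
  assumes "1 \<le> M" "M \<le> N"
  defines "S \<equiv> {p. prime p \<and> p \<le> N \<and> M < p ^ top_exp N p}"
  shows "psi N - psi M \<le> (\<Sum>p\<in>S. real (top_exp N p) * ln (real p))"
proof -
  define Q where "Q = {q \<in> {M<..N}. primepow q}"
  have fin: "finite S" "finite Q" by (auto simp: S_def Q_def)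
  have "psi N = (\<Sum>d\<in>{1..N} - {1..M}. mangoldt d) + psi M"
    unfolding psi_def by (rule sum.subset_diff) (use assms in auto)
  also have "{1..N} - {1..M} = {M<..N}" by auto
  finally have "psi N - psi M = (\<Sum>d\<in>{M<..N}. mangoldt d)" by simp
  also have "\<dots> = (\<Sum>q\<in>Q. ln (real (aprimedivisor q)))"
    unfolding Q_def by (intro sum.mono_neutral_cong_right) (auto simp: mangoldt_def)
  also have "\<dots> = (\<Sum>p\<in>S. \<Sum>q\<in>{q \<in> Q. aprimedivisor q = p}. ln (real (aprimedivisor q)))"
  proof (rule sum.group[OF fin(2,1), symmetric])
    show "aprimedivisor ` Q \<subseteq> S"
    proof
      fix p assume "p \<in> aprimedivisor ` Q"
      then obtain q where q: "q \<in> Q" "p = aprimedivisor q" by auto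
      then have "primepow q" by (simp add: Q_def)
      then obtain p' k where pk: "prime p'" "k > 0" "q = p' ^ k" by (auto simp: primepow_def)
      then have p: "p = p'" "prime p" using q by (simp_all add: aprimedivisor_prime_power)
      have p2: "2 \<le> p" using p prime_ge_2_nat by blast
      have qN: "p ^ k \<le> N" "M < p ^ k" using q pk p by (auto simp: Q_def)
      then have "k \<le> top_exp N p" using top_exp(2)[of p N k] p2 assms by simp
      then have "p ^ k \<le> p ^ top_exp N p" using p2 by (intro power_increasing) auto
      moreover have "p \<le> p ^ k" using pk(2) p2 by (intro self_le_power) auto
      ultimately show "p \<in> S" using p qN by (simp add: S_def)
    qed
  qed
  also have "\<dots> \<le> (\<Sum>p\<in>S. real (top_exp N p) * ln (real p))"
  proof (rule sum_mono)
    fix p assume "p \<in> S"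
    then have p: "prime p" "2 \<le> p" using prime_ge_2_nat by (auto simp: S_def)
    have "{q \<in> Q. aprimedivisor q = p} \<subseteq> (\<lambda>k. p ^ k) ` {1..top_exp N p}"
    proof
      fix q assume q: "q \<in> {q \<in> Q. aprimedivisor q = p}"
      then have "primepow q" by (simp add: Q_def)
      then obtain p' k where pk: "prime p'" "k > 0" "q = p' ^ k" by (auto simp: primepow_def)
      then have "p' = p" using q by (simp add: aprimedivisor_prime_power)
      with pk q have "q = p ^ k" "1 \<le> k" "p ^ k \<le> N" by (auto simp: Q_def)
      then show "q \<in> (\<lambda>k. p ^ k) ` {1..top_exp N p}"
        using top_exp(2)[of p N k] p assms by auto
    qed
    then have "card {q \<in> Q. aprimedivisor q = p} \<le> card {1..top_exp N p}"
      by (rule surj_card_le[rotated]) simp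
    moreover have "(\<Sum>q\<in>{q \<in> Q. aprimedivisor q = p}. ln (real (aprimedivisor q))) =
        real (card {q \<in> Q. aprimedivisor q = p}) * ln (real p)"
      by simp
    ultimately show "(\<Sum>q\<in>{q \<in> Q. aprimedivisor q = p}. ln (real (aprimedivisor q))) \<le>
        real (top_exp N p) * ln (real p)"
      using p by (simp add: mult_right_mono)
  qed
  finally show ?thesis .
qed

lemma ln_ge_4000:
  assumes "4000 \<le> x"
  shows "8.29 \<le> ln (x::real)" "(ln x)\<^sup>2 \<le> x / 50"
proof -
  have "ln (4000::real) = ln (2 ^ 5 * 5 ^ 3)" by simp
  also have "\<dots> = ln (2 ^ 5) + ln (5 ^ 3)" by (rule ln_mult_pos) simp_all
  also have "\<dots> = 5 * ln 2 + 3 * ln 5" by (subst (1 2) ln_realpow) simp_all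
  finally have "8.29 \<le> ln (4000::real)" using ln_2_bounds ln_5_bounds by simp
  also have "\<dots> \<le> ln x" using assms by simp
  finally show l: "8.29 \<le> ln x" .
  \<comment> \<open>On the square root scale \<open>ln\<close> is bounded by its tangent at 40; the
    last estimate uses \<open>0.1414\<^sup>2 < 1/50\<close>.\<close>
  define y where "y = sqrt x"
  have "63 \<le> y" unfolding y_def using assms by (intro real_le_rsqrt) simp
  have "ln (40::real) = ln (2 ^ 3 * 5)" by simp
  also have "\<dots> = ln (2 ^ 3) + ln 5" by (rule ln_mult_pos) simp_all
  also have "\<dots> = 3 * ln 2 + ln 5" by (subst ln_realpow) simp_all
  finally have "ln (40::real) \<le> 3.689" using ln_2_bounds ln_5_bounds by simp
  moreover have "ln (y / 40) \<le> y / 40 - 1" using \<open>63 \<le> y\<close> by (intro ln_le_minus_one) simp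
  moreover have "ln (y / 40) = ln y - ln 40" using \<open>63 \<le> y\<close> by (simp add: ln_div)
  moreover have "ln x = 2 * ln y" unfolding y_def using assms by (simp add: ln_sqrt)
  ultimately have "ln x \<le> 5.378 + y / 20" by simp
  also have "\<dots> \<le> 0.1414 * y" using \<open>63 \<le> y\<close> by simp
  finally have "(ln x)\<^sup>2 \<le> (0.1414 * y)\<^sup>2" using l by (intro power_mono) auto
  also have "\<dots> \<le> x / 50" using assms by (simp add: y_def power_mult_distrib) (simp add: power2_eq_square)
  finally show "(ln x)\<^sup>2 \<le> x / 50" .
qed

lemma ln_20_7_bounds: "1.04 \<le> ln (20 / 7 :: real)" "ln (20 / 7 :: real) \<le> 1.05"
  using ln_approx_bounds[of "20 / 7" 6] by (simp_all add: eval_nat_numeral)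

text \<open>The main terms leave \<open>0.9212 - 1.11 * 7/20 = 0.5327\<close> times
  \<open>N\<close>; the excess over one half absorbs the logarithmic errors from 4000 on.\<close>

lemma psi_diff_ge:
  assumes "4000 \<le> N"
  shows "real N / 2 \<le> psi N - psi (7 * N div 20)"
proof -
  define M where "M = 7 * N div 20"
  define l where "l = ln (real N)"
  have l: "8.29 \<le> l" "l\<^sup>2 \<le> N / 50" using ln_ge_4000[of "real N"] assms by (auto simp: l_def)
  have M: "1 \<le> M" "real M \<le> 7 / 20 * N"
    using assms of_nat_div_le_of_nat[of "7 * N" 20, where ?'a = real] by (auto simp: M_def)
  have "ln M \<le> ln (N / (20 / 7))" using M assms by (subst ln_le_cancel_iff) auto
  also have "\<dots> = l - ln (20 / 7)" unfolding l_def using assms by (subst ln_div) auto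
  also have "\<dots> \<le> l - 1.04" using ln_20_7_bounds by simp
  finally have "(ln M)\<^sup>2 \<le> (l - 1.04)\<^sup>2" using M by (intro power_mono) auto
  moreover have "psi M \<le> 1.11 * M + 1.4 * (ln M)\<^sup>2" using psi_le M by simp
  ultimately have "psi M \<le> 1.11 * (7 / 20 * N) + 1.4 * (l - 1.04)\<^sup>2" using M(2) by simp
  also have "(l - 1.04)\<^sup>2 = l\<^sup>2 - 2.08 * l + 1.0816" by (simp add: power2_eq_square algebra_simps)
  finally have "psi M \<le> 777 / 2000 * N + 7 / 5 * l\<^sup>2 - 364 / 125 * l + 4732 / 3125"
    by (simp add: algebra_simps)
  moreover have "2303 / 2500 * real N - 4 * l + 29 / 5 \<le> psi N"
    using psi_ge[of N] assms by (simp add: l_def)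
  moreover have "8 * l \<le> N / 50"
  proof -
    have "8 * l \<le> l * l" using l(1) by (intro mult_right_mono) auto
    then show ?thesis using l(2) by (simp add: power2_eq_square)
  qed
  ultimately show ?thesis using l(2) unfolding M_def by linarith
qed

text \<open>With \<open>l = ln x\<close> the hypothesis gives
  \<open>k \<le> x / (2 * (l - 1.05))\<close>, and \<open>1.2762 > 1.05\<close> leaves room for one
  more modulus.\<close>

lemma rate_large:
  assumes "4000 \<le> x" "0 \<le> k" "k * ln (x / (20 / 7)) \<le> x / 2"
  shows "1 + k < rate x"
proof -
  define l u where "l = ln x" and "u = ln (20 / 7 :: real)"
  have u: "1.04 \<le> u" "u \<le> 1.05" using ln_20_7_bounds by (auto simp: u_def)
  have l: "8.29 \<le> l" "l\<^sup>2 \<le> x / 50" using ln_ge_4000[OF assms(1)] by (auto simp: l_def)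
  have "ln (x / (20 / 7)) = l - u"
    unfolding l_def u_def using assms by (subst ln_div) auto
  then have "k * (l - u) \<le> x / 2" using assms(3) by simp
  moreover have "k * (l - 1.05) \<le> k * (l - u)"
    using u(2) assms(2) by (intro mult_left_mono) auto
  ultimately have "k * (l - 1.05) \<le> x / 2" by linarith
  then have k: "k \<le> x / (2 * (l - 1.05))" using l(1) by (simp add: field_simps)
  have "2 * l\<^sup>2 * (l - 1.05) \<le> 2 * l\<^sup>2 * l"
    using l(1) by (intro mult_left_mono) auto
  also have "\<dots> \<le> 2 * (x / 50) * l" using l by (intro mult_right_mono) auto
  also have "\<dots> = (0.04 * l) * x" by simp
  \<comment> \<open>The factor is \<open>(l + 1.2762) * (l - 1.05) - l\<^sup>2\<close>, which
    exceeds \<open>0.04 * l\<close> because \<open>l \<ge> 8.29\<close>.\<close>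
  also have "\<dots> < (0.2262 * l - 1.34001) * x"
    using l(1) assms(1) by (intro mult_strict_right_mono) auto
  finally have "2 * l\<^sup>2 * (l - 1.05) < x * ((l + 1.2762) * (l - 1.05) - l\<^sup>2)"
    by (simp add: algebra_simps power2_eq_square)
  then have "2 * l\<^sup>2 * (l - 1.05) + x * l\<^sup>2 < x * (l + 1.2762) * (l - 1.05)"
    by (simp add: algebra_simps)
  then have "1 + x / (2 * (l - 1.05)) < x * (l + 1.2762) / (2 * l\<^sup>2)"
    using l(1) by (simp add: field_simps)
  also have "\<dots> = rate x"
    unfolding rate_def l_def[symmetric] using l(1) by (simp add: field_simps power2_eq_square)
  finally show ?thesis using k by simp
qed

text \<open>The witness is a subset of minimal size, so that removing one modulus drops the product
  below \<open>m\<close>; as every modulus exceeds \<open>7 N / 20\<close>, this bounds the size.\<close>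

lemma good_sequence_large:
  assumes N: "4000 \<le> N" and m: "1 \<le> m" "ln (real m) \<le> real N / 2"
  shows "\<exists>ps. good_sequence (real N) m ps"
proof -
  define M where "M = 7 * N div 20"
  define q where "q = (\<lambda>p. p ^ top_exp N p)"
  define S where "S = {p. prime p \<and> p \<le> N \<and> M < q p}"
  have fin: "finite S" by (simp add: S_def)
  have MN: "1 \<le> M" "M \<le> N" using N by (auto simp: M_def)
  have q_pos: "0 < q p" if "p \<in> S" for p using that by (simp add: S_def)
  have q_le: "q p \<le> N" if "p \<in> S" for p
    using that top_exp(1)[of p N] prime_ge_2_nat[of p] N by (simp add: S_def q_def)
  have q_ge: "N / (20 / 7) \<le> q p" if "p \<in> S" for p
  proof -
    have "7 * N div 20 < q p" using that by (simp add: S_def M_def)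
    then have "7 * N \<le> q p * 20" by linarith
    then have "real (7 * N) \<le> real (q p * 20)" by (simp only: of_nat_le_iff)
    then show ?thesis by simp
  qed
  define F where "F = (\<lambda>A. A \<subseteq> S \<and> m \<le> (\<Prod>p\<in>A. q p))"
  \<comment> \<open>The logarithm of the full product is at least
    \<open>psi N - psi M \<ge> N / 2\<close>.\<close>
  have "F S"
  proof -
    have "ln (real m) \<le> psi N - psi M" using psi_diff_ge[OF N] m(2) unfolding M_def by linarith
    also have "\<dots> \<le> (\<Sum>p\<in>S. real (top_exp N p) * ln (real p))"
      using psi_diff_le_top_exp[OF MN] by (simp add: S_def q_def)
    also have "\<dots> = (\<Sum>p\<in>S. ln (real (q p)))"
      by (intro sum.cong refl) (auto simp: q_def S_def ln_realpow prime_gt_0_nat)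
    also have "\<dots> = ln (real (\<Prod>p\<in>S. q p))"
      using fin q_pos by (subst of_nat_prod, subst ln_prod) auto
    finally have "real m \<le> real (\<Prod>p\<in>S. q p)"
      using m(1) q_pos by (subst (asm) ln_le_cancel_iff) (auto intro!: prod_pos)
    then show ?thesis by (simp add: F_def flip: of_nat_prod)
  qed
  obtain A where A: "F A" and least: "\<And>B. F B \<Longrightarrow> card A \<le> card B"
    using ex_has_least_nat[of F S card] \<open>F S\<close> by blast
  then have AS: "A \<subseteq> S" "finite A" using fin finite_subset by (auto simp: F_def)
  have card: "real (card A) < rate N"
  proof -
    have "(card A - 1) * ln (N / (20 / 7)) \<le> N / 2"
    proof (cases "A = {}")
      case False
      then obtain p where p: "p \<in> A" by auto
      then have c: "card (A - {p}) < card A" "card (A - {p}) = card A - 1"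
        using AS card_Diff1_less[of A p] by simp_all
      then have "\<not> F (A - {p})" using least[of "A - {p}"] by linarith
      then have "(\<Prod>p\<in>A - {p}. q p) < m" using AS by (auto simp: F_def)
      then have less: "real (\<Prod>p\<in>A - {p}. q p) < real m" by (simp only: of_nat_less_iff)
      have "(N / (20 / 7)) ^ (card A - 1) = (\<Prod>p\<in>A - {p}. N / (20 / 7))" using c by simp
      also have "\<dots> \<le> (\<Prod>p\<in>A - {p}. real (q p))"
      proof (rule prod_mono)
        fix p' assume "p' \<in> A - {p}"
        then have "p' \<in> S" using AS by blast
        from q_ge[OF this] show "0 \<le> real N / (20 / 7) \<and> real N / (20 / 7) \<le> real (q p')" by simp
      qed
      also have "\<dots> < real m" using less by simp
      finally have "ln ((N / (20 / 7)) ^ (card A - 1)) < ln (real m)"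
        using N m(1) by (subst ln_less_cancel_iff) auto
      also have "ln ((N / (20 / 7)) ^ (card A - 1)) = (card A - 1) * ln (N / (20 / 7))"
        by (rule ln_realpow)
      finally show ?thesis using m(2) by linarith
    qed simp
    then have "1 + real (card A - 1) < rate N" using N by (intro rate_large) auto
    then show ?thesis by linarith
  qed
  define ps where "ps = map (\<lambda>p. (p, top_exp N p)) (sorted_list_of_set A)"
  have moduli: "moduli ps = map q (sorted_list_of_set A)"
    by (simp add: ps_def moduli_def q_def)
  have "prime p \<and> 1 \<le> top_exp N p" if "p \<in> A" for p
  proof -
    have "prime p" "p \<le> N" using that AS by (auto simp: S_def)
    then show ?thesis using top_exp(2)[of p N 1] prime_ge_2_nat[of p] N by simp
  qed
  then have "\<forall>(p, e)\<in>set ps. prime p \<and> e \<ge> 1" using AS(2) by (auto simp: ps_def)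
  moreover have "distinct (map fst ps)" by (simp add: ps_def comp_def)
  moreover have "prod_list (moduli ps) = (\<Prod>p\<in>A. q p)"
    using AS(2) by (simp add: moduli prod.distinct_set_conv_list[symmetric])
  moreover have "real (length ps) < rate N" using card AS(2) by (simp add: ps_def)
  moreover have "real (sum_list (moduli ps)) < N * rate N"
  proof -
    have "sum_list (moduli ps) = (\<Sum>p\<in>A. q p)"
      using AS(2) by (simp add: moduli sum.distinct_set_conv_list[symmetric])
    also have "\<dots> \<le> (\<Sum>p\<in>A. N)" using AS by (intro sum_mono q_le) auto
    finally have "real (sum_list (moduli ps)) \<le> real (card A * N)"
      by (simp only: of_nat_le_iff sum_constant) simp
    also have "\<dots> < rate N * N" using card N by simp
    finally show ?thesis by (simp add: mult.commute)
  qed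
  ultimately have "good_sequence N m ps" using A by (simp add: good_sequence_def F_def)
  then show ?thesis by blast
qed

section \<open>Primes for small parameters\<close>

definition small_primes :: "int list" where
  "small_primes = [2, 3, 5, 7, 11, 13, 17, 19, 23, 29, 31, 37, 41, 43, 47, 53, 59, 61, 67]"

text \<open>5041 is the square of 71, the first prime missing from \<open>small_primes\<close>, so
  trial division by the list decides primality in this range.\<close>

definition prime_test :: "int \<Rightarrow> bool" where
  "prime_test p \<longleftrightarrow> 1 < p \<and> p < 5041 \<and> list_all (\<lambda>q. p = q \<or> p mod q \<noteq> 0) small_primes"

text \<open>In a factorisation of a composite number the smaller factor is below 71, so a listed
  prime divides it. The test forces \<open>p\<close> to be that prime, yet \<open>p\<close> cannot
  divide a smaller positive number.\<close>

lemma prime_if_prime_test: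
  assumes "prime_test p"
  shows "prime (nat p)"
proof (rule ccontr)
  define n where "n = nat p"
  assume "\<not> prime (nat p)"
  then have np: "\<not> prime n" by (simp add: n_def)
  have n: "1 < n" "n < 71\<^sup>2" using assms by (auto simp: n_def prime_test_def)
  obtain r where r: "prime r" "r dvd n" using n(1) prime_factor_nat[of n] by auto
  then obtain s where s: "n = r * s" by (elim dvdE)
  have "r \<noteq> n" using r(1) np by auto
  then have s1: "1 < s" using s n(1) by (cases "s = 0 \<or> s = 1") auto
  define k where "k = min r s"
  have k: "1 < k" "k dvd n" "k < n"
    using s s1 prime_gt_1_nat[OF r(1)] by (auto simp: k_def min_def)
  have "k * k \<le> n" unfolding s k_def by (rule mult_le_mono) auto
  then have "k\<^sup>2 < 71\<^sup>2" using n(2) by (simp add: power2_eq_square)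
  then have "k < 71" by (rule power_less_imp_less_base) simp
  with k(1) have "k \<in> {2..<71}" by simp
  moreover have "\<forall>k\<in>{2..<71::nat}. \<exists>q\<in>set small_primes. q dvd int k"
    by (simp add: atLeastLessThan_nat_numeral small_primes_def)
  ultimately obtain q where q: "q \<in> set small_primes" "q dvd int k"
    by blast
  then have "q dvd int n" using k(2) dvd_trans by fastforce
  then have "q dvd p" using assms by (simp add: n_def prime_test_def)
  then have "p = q" using assms q(1) by (auto simp: prime_test_def list_all_iff dvd_eq_mod_eq_0)
  then have "n dvd k" using q(2) assms by (simp add: n_def prime_test_def nat_dvd_iff)
  then show False using k by (auto dest: dvd_imp_le)
qed

text \<open>Odd primes, grouped by the value of \<open>\<lfloor>16 log\<^sub>2 p\<rfloor>\<close>.\<close>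

definition prime_classes :: "(int \<times> int list) list" where
  "prime_classes = [
    (25, [3]), (37, [5]), (44, [7]), (55, [11]), (59, [13]), (65, [17]), (67, [19]),
    (72, [23]), (77, [29]), (79, [31]), (83, [37]), (85, [41]), (86, [43]), (88, [47]),
    (91, [53]), (94, [59, 61]), (97, [67]), (98, [71]), (99, [73]), (100, [79]), (102, [83]),
    (103, [89]), (105, [97]), (106, [101, 103]), (107, [107]), (108, [109]), (109, [113]),
    (111, [127]), (112, [131]), (113, [137, 139]), (115, [149, 151]), (116, [157]),
    (117, [163]), (118, [167, 173]), (119, [179, 181]), (121, [191, 193, 197]), (122, [199]),
    (123, [211]), (124, [223]), (125, [227, 229, 233]), (126, [239, 241]), (127, [251]),
    (128, [257, 263]), (129, [269, 271, 277]), (130, [281, 283]), (131, [293]),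
    (132, [307, 311, 313, 317]), (133, [331]), (134, [337]), (135, [347, 349, 353, 359]),
    (136, [367, 373]), (137, [379, 383, 389]), (138, [397, 401, 409]), (139, [419, 421]),
    (140, [431, 433, 439, 443, 449]), (141, [457, 461, 463, 467]), (142, [479, 487]),
    (143, [491, 499, 503, 509]), (144, [521, 523]), (145, [541, 547, 557]),
    (146, [563, 569, 571, 577]), (147, [587, 593, 599, 601, 607]), (148, [613, 617, 619, 631]),
    (149, [641, 643, 647, 653, 659, 661]), (150, [673, 677, 683, 691]), (151, [701, 709, 719]),
    (152, [727, 733, 739, 743, 751]), (153, [757, 761, 769, 773, 787]),
    (154, [797, 809, 811, 821, 823]), (155, [827, 829, 839, 853, 857, 859]),
    (156, [863, 877, 881, 883, 887]), (157, [907, 911, 919, 929, 937]),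
    (158, [941, 947, 953, 967, 971, 977]), (159, [983, 991, 997, 1009, 1013, 1019, 1021]),
    (160, [1031, 1033, 1039, 1049, 1051, 1061, 1063, 1069]),
    (161, [1087, 1091, 1093, 1097, 1103, 1109]), (162, [1117, 1123, 1129, 1151, 1153, 1163]),
    (163, [1171, 1181, 1187, 1193, 1201, 1213, 1217]),
    (164, [1223, 1229, 1231, 1237, 1249, 1259]),
    (165, [1277, 1279, 1283, 1289, 1291, 1297, 1301, 1303, 1307, 1319, 1321, 1327]),
    (166, [1361, 1367, 1373, 1381]), (167, [1399, 1409, 1423, 1427, 1429, 1433, 1439, 1447]),
    (168, [1451, 1453, 1459, 1471, 1481, 1483, 1487, 1489, 1493, 1499, 1511]),
    (169, [1523, 1531, 1543, 1549, 1553, 1559, 1567, 1571, 1579]),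
    (170, [1583, 1597, 1601, 1607, 1609, 1613, 1619, 1621, 1627, 1637]),
    (171, [1657, 1663, 1667, 1669, 1693, 1697, 1699, 1709, 1721]),
    (172, [1723, 1733, 1741, 1747, 1753, 1759, 1777, 1783, 1787, 1789]),
    (173, [1801, 1811, 1823, 1831, 1847, 1861, 1867, 1871, 1873, 1877]),
    (174, [1879, 1889, 1901, 1907, 1913, 1931, 1933, 1949, 1951]),
    (175, [1973, 1979, 1987, 1993, 1997, 1999, 2003, 2011, 2017, 2027, 2029, 2039]),
    (176, [2053, 2063, 2069, 2081, 2083, 2087, 2089, 2099, 2111, 2113, 2129, 2131, 2137]),
    (177, [2141, 2143, 2153, 2161, 2179, 2203, 2207, 2213, 2221]),
    (178, [2237, 2239, 2243, 2251, 2267, 2269, 2273, 2281, 2287, 2293, 2297, 2309, 2311]),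
    (179, [2333, 2339, 2341, 2347, 2351, 2357, 2371, 2377, 2381, 2383, 2389, 2393, 2399, 2411, 2417, 2423]),
    (180, [2437, 2441, 2447, 2459, 2467, 2473, 2477, 2503, 2521, 2531, 2539, 2543]),
    (181, [2549, 2551, 2557, 2579, 2591, 2593, 2609, 2617, 2621, 2633, 2647]),
    (182, [2657, 2659, 2663, 2671, 2677, 2683, 2687, 2689, 2693, 2699, 2707, 2711, 2713, 2719, 2729, 2731, 2741, 2749, 2753, 2767]),
    (183, [2777, 2789, 2791, 2797, 2801, 2803, 2819, 2833, 2837, 2843, 2851, 2857, 2861, 2879, 2887]),
    (184, [2897, 2903, 2909, 2917, 2927, 2939, 2953, 2957, 2963, 2969, 2971, 2999, 3001, 3011, 3019, 3023]),
    (185, [3037, 3041, 3049, 3061, 3067, 3079, 3083, 3089, 3109, 3119, 3121, 3137]),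
    (186, [3163, 3167, 3169, 3181, 3187, 3191, 3203, 3209, 3217, 3221, 3229, 3251, 3253, 3257, 3259, 3271]),
    (187, [3299, 3301, 3307, 3313, 3319, 3323, 3329, 3331, 3343, 3347, 3359, 3361, 3371, 3373, 3389, 3391, 3407, 3413, 3433]),
    (188, [3449, 3457, 3461, 3463, 3467, 3469, 3491, 3499, 3511, 3517, 3527, 3529, 3533, 3539, 3541, 3547, 3557, 3559, 3571, 3581, 3583, 3593]),
    (189, [3607, 3613, 3617, 3623, 3631, 3637, 3643, 3659, 3671, 3673, 3677, 3691, 3697, 3701, 3709, 3719, 3727, 3733, 3739]),
    (190, [3761, 3767, 3769, 3779, 3793, 3797, 3803, 3821, 3823, 3833, 3847, 3851, 3853, 3863, 3877, 3881, 3889, 3907, 3911, 3917, 3919]),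
    (191, [3923, 3929, 3931, 3943, 3947, 3967, 3989, 4001, 4003, 4007, 4013, 4019, 4021, 4027, 4049, 4051, 4057, 4073, 4079, 4091, 4093]),
    (192, [4099, 4111, 4127, 4129, 4133, 4139, 4153, 4157, 4159, 4177, 4201, 4211, 4217, 4219, 4229, 4231, 4241, 4243, 4253, 4259, 4261, 4271, 4273]),
    (193, [4283, 4289, 4297, 4327, 4337, 4339, 4349, 4357, 4363, 4373, 4391, 4397, 4409, 4421, 4423, 4441, 4447, 4451, 4457, 4463]),
    (194, [4481, 4483, 4493, 4507, 4513, 4517, 4519, 4523, 4547, 4549, 4561, 4567, 4583, 4591, 4597, 4603, 4621, 4637, 4639, 4643, 4649, 4651, 4657, 4663])]"

lemma prime_classes_test: "list_all (\<lambda>(w, ps). list_all prime_test ps) prime_classes"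
  by code_simp

text \<open>Integer form of \<open>w \<le> 16 * log 2 p\<close>, tested at the least prime of each
  class.\<close>

lemma prime_classes_weight:
  "list_all (\<lambda>(w, ps). 0 \<le> w \<and> 2 ^ nat w \<le> hd ps ^ 16 \<and> list_all (\<lambda>p. hd ps \<le> p) ps) prime_classes"
  unfolding prime_classes_def by simp

lemma sorted_prime_classes: "sorted_wrt (<) (concat (map snd prime_classes))"
  unfolding prime_classes_def by (simp add: sorted_wrt2_simps del: sorted_wrt.simps)

text \<open>Size, sum and total weight of each class, tabulated so that segments are checked without
  touching the primes.\<close>

definition class_totals :: "(int \<times> int \<times> int) list" where
  "class_totals = [
    (1, 3, 25), (1, 5, 37), (1, 7, 44), (1, 11, 55), (1, 13, 59), (1, 17, 65), (1, 19, 67),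
    (1, 23, 72), (1, 29, 77), (1, 31, 79), (1, 37, 83), (1, 41, 85), (1, 43, 86), (1, 47, 88),
    (1, 53, 91), (2, 120, 188), (1, 67, 97), (1, 71, 98), (1, 73, 99), (1, 79, 100),
    (1, 83, 102), (1, 89, 103), (1, 97, 105), (2, 204, 212), (1, 107, 107), (1, 109, 108),
    (1, 113, 109), (1, 127, 111), (1, 131, 112), (2, 276, 226), (2, 300, 230), (1, 157, 116),
    (1, 163, 117), (2, 340, 236), (2, 360, 238), (3, 581, 363), (1, 199, 122), (1, 211, 123),
    (1, 223, 124), (3, 689, 375), (2, 480, 252), (1, 251, 127), (2, 520, 256), (3, 817, 387),
    (2, 564, 260), (1, 293, 131), (4, 1248, 528), (1, 331, 133), (1, 337, 134), (4, 1408, 540),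
    (2, 740, 272), (3, 1151, 411), (3, 1207, 414), (2, 840, 278), (5, 2195, 700),
    (4, 1848, 564), (2, 966, 284), (4, 2002, 572), (2, 1044, 288), (3, 1645, 435),
    (4, 2280, 584), (5, 2987, 735), (4, 2480, 592), (6, 3904, 894), (4, 2724, 600),
    (3, 2129, 453), (5, 3693, 760), (5, 3847, 765), (5, 4061, 770), (6, 5064, 930),
    (5, 4391, 780), (5, 4603, 785), (6, 5756, 948), (7, 7033, 1113), (8, 8396, 1280),
    (6, 6580, 966), (6, 6836, 972), (7, 8363, 1141), (6, 7428, 984), (12, 15594, 1980),
    (4, 5482, 664), (8, 11406, 1336), (11, 16277, 1848), (9, 13975, 1521), (10, 16114, 1700),
    (9, 15175, 1539), (10, 17592, 1720), (10, 18462, 1730), (9, 17253, 1566),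
    (12, 24054, 2100), (13, 27245, 2288), (9, 19621, 1593), (13, 29557, 2314),
    (16, 38012, 2864), (12, 29838, 2160), (11, 28547, 1991), (20, 54098, 3640),
    (15, 42425, 2745), (16, 47358, 2944), (12, 36992, 2220), (16, 51428, 2976),
    (19, 63709, 3553), (22, 77444, 4136), (19, 69767, 3591), (21, 80661, 3990),
    (21, 84213, 4011), (23, 96493, 4416), (20, 87614, 3860), (24, 109794, 4656)]"

lemma class_totals:
  "class_totals = map (\<lambda>(w, ps). (int (length ps), sum_list ps, w * int (length ps))) prime_classes"
  unfolding class_totals_def prime_classes_def by simp

text \<open>The number \<open>69315 v / 1600000\<close> is an upper bound for \<open>ln L\<close>, and \<open>3267072000000\<close> is
  \<open>1.2762 \<cdot> 1600000\<^sup>2\<close>.\<close>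

definition totals_ok :: "int \<Rightarrow> int \<Rightarrow> nat \<Rightarrow> int \<Rightarrow> int \<Rightarrow> int \<Rightarrow> bool" where
  "totals_ok L L' v k s w \<longleftrightarrow> 2 \<le> L \<and> (L = L' \<or> 8 \<le> L) \<and> 80000 * L' \<le> 6931 * w \<and> L ^ 16 \<le> 2 ^ v \<and>
     2 * k * (69315 * int v)\<^sup>2 < L * (69315 * int v * 1600000 + 3267072000000) \<and>
     2 * s * (69315 * int v)\<^sup>2 < L * L * (69315 * int v * 1600000 + 3267072000000)"

text \<open>An entry \<open>(L, L', i, j, v)\<close> says that the primes in the \<open>j\<close> classes from index \<open>i\<close> on are a
  suitable sequence for every value of \<open>\<lceil>2 d ln n\<rceil>\<close> between \<open>L\<close> and \<open>L'\<close>.\<close>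

definition segment_ok :: "int \<times> int \<times> nat \<times> nat \<times> nat \<Rightarrow> bool" where
  "segment_ok = (\<lambda>(L, L', i, j, v). let ts = take j (drop i class_totals) in
     totals_ok L L' v (sum_list (map fst ts)) (sum_list (map (fst \<circ> snd) ts))
       (sum_list (map (snd \<circ> snd) ts)))"

definition segment_table :: "(int \<times> int \<times> nat \<times> nat \<times> nat) list" where
  "segment_table = [
    (2, 2, 0, 2, 16), (3, 3, 0, 2, 26), (4, 4, 0, 2, 32), (5, 5, 1, 2, 38), (6, 6, 1, 2, 42),
    (7, 7, 2, 2, 45), (8, 11, 1, 3, 48), (12, 15, 3, 3, 58), (16, 21, 3, 4, 64),
    (22, 25, 6, 4, 72), (26, 32, 6, 5, 76), (33, 41, 7, 6, 81), (42, 51, 8, 7, 87),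
    (52, 63, 11, 7, 92), (64, 82, 12, 9, 96), (83, 97, 16, 10, 103), (98, 118, 17, 12, 106),
    (119, 142, 20, 12, 111), (143, 175, 22, 13, 115), (176, 211, 24, 15, 120),
    (212, 251, 29, 14, 124), (252, 296, 34, 14, 128), (297, 351, 37, 15, 132),
    (352, 417, 40, 15, 136), (418, 492, 45, 15, 140), (493, 577, 49, 14, 144),
    (578, 676, 51, 15, 147), (677, 779, 54, 15, 151), (780, 894, 58, 15, 154),
    (895, 1041, 63, 14, 157), (1042, 1191, 62, 16, 161), (1192, 1362, 69, 14, 164),
    (1363, 1561, 70, 15, 167), (1562, 1802, 76, 14, 170), (1803, 2070, 79, 14, 174),
    (2071, 2334, 80, 15, 177), (2335, 2648, 82, 15, 180), (2649, 3028, 88, 14, 182),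
    (3029, 3389, 92, 13, 186), (3390, 3737, 92, 14, 188), (3738, 4221, 95, 14, 190)]"

lemma segment_table: "list_all segment_ok segment_table"
  by (simp add: segment_table_def segment_ok_def class_totals_def totals_ok_def)

section \<open>Covering the small parameters by table segments\<close>

fun covers :: "int \<Rightarrow> (int \<times> int \<times> nat \<times> nat \<times> nat) list \<Rightarrow> int \<Rightarrow> bool" where
  "covers a [] b \<longleftrightarrow> b < a"
| "covers a ((L, L', _) # cs) b \<longleftrightarrow> L \<le> a \<and> covers (L' + 1) cs b"

lemma coversD:
  "covers a cs b \<Longrightarrow> a \<le> x \<Longrightarrow> x \<le> b \<Longrightarrow> \<exists>(L, L', c) \<in> set cs. L \<le> x \<and> x \<le> L'"
proof (induction a cs b rule: covers.induct)
  case (2 a L L' c cs b)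
  show ?case
  proof (cases "x \<le> L'")
    case True
    with 2 show ?thesis by auto
  next
    case False
    with 2 have "\<exists>(L, L', c)\<in>set cs. L \<le> x \<and> x \<le> L'" by auto
    then show ?thesis by auto
  qed
qed simp

lemma covers_segment_table: "covers 2 segment_table 3999"
  by (simp add: segment_table_def)

text \<open>Lets a segment be checked at its left end. \<open>x / ln x\<close> increases from
  \<open>e\<close> on, and \<open>x / (ln x)\<^sup>2\<close> is a quarter of the square of that
  function at \<open>sqrt x\<close>, so \<open>8 > e\<^sup>2\<close> suffices;
  \<open>0.159525 = 1.2762 / 8\<close>.\<close>

lemma rate_mono:
  assumes "8 \<le> x" "x \<le> y"
  shows "rate x \<le> rate y"
proof -
  have incr: "a / ln a \<le> b / ln b" if "1 \<le> ln a" "0 < a" "a \<le> b" for a b :: real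
  proof -
    have "ln b - ln a = ln (b / a)" using that by (simp add: ln_div)
    also have "\<dots> \<le> b / a - 1" using that by (intro ln_le_minus_one) auto
    finally have "a * (ln b - ln a) \<le> b - a" using that by (simp add: field_simps)
    also have "\<dots> \<le> (b - a) * ln a" using that by (simp add: mult_le_cancel_left1)
    finally have "a * ln b \<le> b * ln a" by (simp add: algebra_simps)
    moreover have "0 < ln a" "0 < ln b" using that ln_le_cancel_iff[of a b] by linarith+
    ultimately show ?thesis by (simp add: field_simps)
  qed
  have "ln (8::real) = 3 * ln 2" using ln_realpow[of 2 3] by simp
  then have "2 \<le> ln (8::real)" using ln_2_bounds by simp
  also have "\<dots> \<le> ln x" using assms by simp
  finally have x: "2 \<le> ln x" .
  have r: "rate z = (z / ln z) / 2 + 0.159525 * (sqrt z / ln (sqrt z))\<^sup>2" if "0 < z" "0 < ln z" for z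
    using that unfolding rate_def by (simp add: ln_sqrt power_divide field_simps)
      (simp add: power2_eq_square)
  have "x / ln x \<le> y / ln y" using x assms by (intro incr) auto
  moreover have "(sqrt x / ln (sqrt x))\<^sup>2 \<le> (sqrt y / ln (sqrt y))\<^sup>2"
    using x assms by (intro power_mono incr) (auto simp: ln_sqrt)
  moreover have "0 < ln y" using x assms ln_le_cancel_iff[of x y] by linarith
  ultimately have "(x / ln x) / 2 + 0.159525 * (sqrt x / ln (sqrt x))\<^sup>2 \<le>
      (y / ln y) / 2 + 0.159525 * (sqrt y / ln (sqrt y))\<^sup>2"
    by (intro add_mono mult_left_mono divide_right_mono) auto
  then show ?thesis using x assms \<open>0 < ln y\<close> by (simp add: r)
qed

text \<open>The bound decreases as the logarithm grows, so an upper estimate \<open>u\<close> is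
  safe; clearing denominators gives the inequality that \<open>totals_ok\<close> tests over the
  integers.\<close>

lemma less_rate:
  assumes "1 < x" "ln x \<le> u" "2 * k * u\<^sup>2 < x * (u + 1.2762)"
  shows "k < rate x"
proof -
  have l: "0 < ln x" "0 < u" using assms by (auto intro: less_le_trans[OF ln_gt_zero])
  have "k < x / (2 * u) * (1 + 1.2762 / u)"
    using assms(3) l by (simp add: field_simps power2_eq_square)
  also have "\<dots> \<le> rate x"
    unfolding rate_def using l assms
    by (intro mult_mono add_mono divide_left_mono mult_left_mono) auto
  finally show ?thesis .
qed

lemma prime_class:
  assumes "(w, ps) \<in> set prime_classes" "p \<in> set ps"
  shows "0 \<le> w" "prime (nat p)" "2 ^ nat w \<le> nat p ^ 16"
proof -
  have "list_all prime_test ps"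
    using bspec[OF prime_classes_test[unfolded list_all_iff] assms(1)] by (simp add: list_all_iff)
  moreover have "hd ps \<in> set ps" using assms(2) by (intro hd_in_set) auto
  ultimately have test: "prime_test p" "prime_test (hd ps)"
    using assms(2) by (simp_all add: list_all_iff)
  from test(1) show "prime (nat p)" by (rule prime_if_prime_test)
  have w: "0 \<le> w" "2 ^ nat w \<le> hd ps ^ 16" "hd ps \<le> p"
    using bspec[OF prime_classes_weight[unfolded list_all_iff] assms(1)] assms(2)
    by (auto simp: list_all_iff)
  show "0 \<le> w" by (rule w)
  note w(2)
  also have "hd ps ^ 16 \<le> p ^ 16"
    using w(3) test(2) by (intro power_mono) (auto simp: prime_test_def)
  also have "p = int (nat p)" using test(1) by (simp add: prime_test_def)
  finally have "int (2 ^ nat w) \<le> int (nat p ^ 16)" by simp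
  then show "2 ^ nat w \<le> nat p ^ 16" by (simp only: of_nat_le_iff)
qed

lemma ln_prod_list_ge:
  assumes "\<And>p. p \<in> set xs \<Longrightarrow> prime p \<and> 2 ^ w \<le> p ^ 16"
  shows "0.6931 / 16 * (real w * real (length xs)) \<le> ln (real (prod_list xs)) \<and> prod_list xs > 0"
  using assms
proof (induction xs)
  case (Cons p xs)
  have p: "prime p" "2 ^ w \<le> p ^ 16" using Cons.prems by auto
  have IH: "0.6931 / 16 * (real w * real (length xs)) \<le> ln (real (prod_list xs))" "prod_list xs > 0"
    using Cons.prems Cons.IH by auto
  have "0.6931 * real w \<le> ln 2 * real w" using ln_2_bounds by (intro mult_right_mono) auto
  also have "\<dots> = ln (2 ^ w)" by (simp add: ln_realpow)
  also have "\<dots> \<le> ln (real (p ^ 16))"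
  proof -
    have "real (2 ^ w) \<le> real (p ^ 16)" using p(2) by (simp only: of_nat_le_iff)
    then show ?thesis using prime_gt_0_nat[OF p(1)] by (subst ln_le_cancel_iff) auto
  qed
  also have "\<dots> = 16 * ln (real p)" using prime_gt_0_nat[OF p(1)] by (simp add: ln_realpow)
  finally have "0.6931 / 16 * real w \<le> ln (real p)" by simp
  then show ?case
    using IH prime_gt_0_nat[OF p(1)] by (simp add: ln_mult algebra_simps)
qed simp

lemma prime_classes_totals:
  fixes cls :: "(int \<times> int list) list"
  assumes "set cls \<subseteq> set prime_classes"
  defines "xs \<equiv> map nat (concat (map snd cls))"
  defines "ts \<equiv> map (\<lambda>(w, ps). (int (length ps), sum_list ps, w * int (length ps))) cls"
  shows "int (length xs) = sum_list (map fst ts)"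
    and "int (sum_list xs) = sum_list (map (fst \<circ> snd) ts)"
    and "0.6931 / 16 * real_of_int (sum_list (map (snd \<circ> snd) ts)) \<le> ln (real (prod_list xs))"
    and "prod_list xs > 0" and "\<forall>p\<in>set xs. prime p"
proof -
  have "int (length xs) = sum_list (map fst ts) \<and> int (sum_list xs) = sum_list (map (fst \<circ> snd) ts) \<and>
    0.6931 / 16 * real_of_int (sum_list (map (snd \<circ> snd) ts)) \<le> ln (real (prod_list xs)) \<and>
    prod_list xs > 0 \<and> (\<forall>p\<in>set xs. prime p)"
    using assms(1) unfolding xs_def ts_def
  proof (induction cls)
    case (Cons c cls)
    obtain w ps where c: "c = (w, ps)" by force
    have ps: "0 \<le> w" "prime (nat p)" "2 ^ nat w \<le> nat p ^ 16" if "p \<in> set ps" for p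
      using prime_class[OF _ that, of w] Cons.prems by (auto simp: c)
    define ys where "ys = map nat ps"
    have ys: "0.6931 / 16 * (real (nat w) * real (length ys)) \<le> ln (real (prod_list ys)) \<and> prod_list ys > 0"
      by (rule ln_prod_list_ge) (use ps in \<open>auto simp: ys_def\<close>)
    have w: "real (nat w) * real (length ys) = real_of_int (w * int (length ps))"
      using ps(1)[OF hd_in_set[of ps]] by (cases "ps = []") (simp_all add: ys_def)
    have "0 \<le> p" if "p \<in> set ps" for p
      using prime_gt_0_nat[OF ps(2)[OF that]] by simp
    then have sum: "int (sum_list ys) = sum_list ps"
      unfolding ys_def by (induction ps) auto
    show ?case
      using Cons.IH Cons.prems ys sum ps(2) unfolding w
      by (auto simp: c ys_def[symmetric] ln_mult algebra_simps) (auto simp: ys_def)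
  qed simp
  then show "int (length xs) = sum_list (map fst ts)"
    and "int (sum_list xs) = sum_list (map (fst \<circ> snd) ts)"
    and "0.6931 / 16 * real_of_int (sum_list (map (snd \<circ> snd) ts)) \<le> ln (real (prod_list xs))"
    and "prod_list xs > 0" and "\<forall>p\<in>set xs. prime p"
    by blast+
qed

text \<open>Strict sortedness of the whole table passes to any block of classes, and
  \<open>nat\<close> is injective on positive integers.\<close>

lemma distinct_class_segment:
  "distinct (map nat (concat (map snd (take j (drop i prime_classes)))))"
proof -
  define as bs cs where "as = take i prime_classes" and "bs = take j (drop i prime_classes)"
    and "cs = drop j (drop i prime_classes)"
  have "prime_classes = as @ bs @ cs" unfolding as_def bs_def cs_def append_take_drop_id ..
  then have "concat (map snd prime_classes) =
      concat (map snd as) @ concat (map snd bs) @ concat (map snd cs)"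
    by (metis concat_append map_append)
  then have "sorted_wrt (<) (concat (map snd as) @ concat (map snd bs) @ concat (map snd cs))"
    using sorted_prime_classes by metis
  then have "sorted_wrt (<) (concat (map snd bs))" by (simp add: sorted_wrt_append)
  then have "distinct (concat (map snd bs))" by (simp add: strict_sorted_iff)
  moreover have "inj_on nat (set (concat (map snd bs)))"
  proof (rule inj_onI)
    fix p q assume "p \<in> set (concat (map snd bs))" "q \<in> set (concat (map snd bs))" "nat p = nat q"
    moreover have "0 < nat p" if "p \<in> set (concat (map snd bs))" for p
    proof -
      from that obtain w ps where "(w, ps) \<in> set bs" "p \<in> set ps" by auto
      moreover from this(1) have "(w, ps) \<in> set prime_classes"
        unfolding bs_def by (meson in_set_dropD in_set_takeD)
      ultimately show ?thesis using prime_class(2) prime_gt_0_nat by blast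
    qed
    ultimately show "p = q" by force
  qed
  ultimately show ?thesis unfolding bs_def[symmetric] by (simp add: distinct_map)
qed

lemma good_sequence_segment:
  assumes cert: "segment_ok (L, L', i, j, v)" and N: "L \<le> int N" "int N \<le> L'"
    and m: "1 \<le> m" "ln (real m) \<le> real N / 2"
  shows "\<exists>ps. good_sequence (real N) m ps"
proof -
  define cls where "cls = take j (drop i prime_classes)"
  define xs where "xs = map nat (concat (map snd cls))"
  define ts where "ts = take j (drop i class_totals)"
  define w where "w = sum_list (map (snd \<circ> snd) ts)"
  define k s where "k = length xs" and "s = sum_list xs"
  have ts: "ts = map (\<lambda>(w, ps). (int (length ps), sum_list ps, w * int (length ps))) cls"
    by (simp add: ts_def cls_def class_totals take_map drop_map)
  have "set cls \<subseteq> set prime_classes"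
    unfolding cls_def by (meson in_set_dropD in_set_takeD subsetI)
  note tot = prime_classes_totals[OF this, folded xs_def ts w_def]
  have ok: "totals_ok L L' v (int k) (int s) w"
    using cert tot(1,2) by (simp add: segment_ok_def Let_def ts_def[symmetric] w_def k_def s_def)
  have L: "2 \<le> L" "2 \<le> N" using ok N by (auto simp: totals_ok_def)
  define l where "l = real_of_int L"
  have l: "2 \<le> l" "l \<le> N" using L N by (auto simp: l_def)
  \<comment> \<open>\<open>L ^ 16 \<le> 2 ^ v\<close> gives \<open>ln L \<le> v * ln 2 / 16\<close>,
    rounded up by \<open>ln 2 < 0.69315\<close>.\<close>
  define u where "u = 0.69315 / 16 * real v"
  have "16 * ln l = ln (l ^ 16)" using l by (simp add: ln_realpow)
  also have "\<dots> \<le> ln (2 ^ v)"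
  proof -
    have "real_of_int (L ^ 16) \<le> real_of_int (2 ^ v)"
      using ok by (simp only: totals_ok_def of_int_le_iff)
    then show ?thesis using l by (subst ln_le_cancel_iff) (auto simp: l_def)
  qed
  also have "\<dots> = real v * ln 2" by (simp add: ln_realpow)
  also have "\<dots> \<le> real v * 0.69315" using ln_2_bounds by (intro mult_left_mono) auto
  finally have u: "ln l \<le> u" by (simp add: u_def)
  \<comment> \<open>Either the segment is a single value, so that \<open>l = N\<close>, or
    \<open>8 \<le> l\<close> and monotonicity applies.\<close>
  have mono: "rate l \<le> rate N"
    using ok N rate_mono[of l "real N"] l by (auto simp: totals_ok_def l_def)
  have v: "real v = 1600000 / 69315 * u" by (simp add: u_def)
  have "real_of_int (2 * int k * (69315 * int v)\<^sup>2) < real_of_int (L * (69315 * int v * 1600000 + 3267072000000))"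
    using ok by (simp only: totals_ok_def of_int_less_iff)
  then have "2 * real k * u\<^sup>2 < l * (u + 1.2762)"
    by (simp add: v l_def power2_eq_square algebra_simps)
  then have "real k < rate l" using l u by (intro less_rate) auto
  then have k: "real k < rate N" using mono by simp
  have "real_of_int (2 * int s * (69315 * int v)\<^sup>2) <
      real_of_int (L * L * (69315 * int v * 1600000 + 3267072000000))"
    using ok by (simp only: totals_ok_def of_int_less_iff)
  then have "2 * real s * u\<^sup>2 < l * (l * (u + 1.2762))"
    by (simp add: v l_def power2_eq_square algebra_simps)
  \<comment> \<open>Division by \<open>l\<close> brings the bound on the sum into the same shape as
    the one on the count.\<close>
  then have "2 * (real s / l) * u\<^sup>2 < l * (u + 1.2762)"
    using l by (simp add: field_simps)
  then have "real s / l < rate l" using l u by (intro less_rate) auto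
  also note mono
  finally have "real s < l * rate N" using l by (simp add: field_simps)
  also have "\<dots> \<le> N * rate N" using l k by (intro mult_right_mono) auto
  finally have s: "real s < N * rate N" .
  \<comment> \<open>\<open>80000 * L' \<le> 6931 * w\<close> is the cleared form of
    \<open>L' / 2 \<le> 0.6931 / 16 * w\<close>.\<close>
  have "ln (real m) \<le> 0.6931 / 16 * real_of_int w"
  proof -
    have "real_of_int (80000 * L') \<le> real_of_int (6931 * w)"
      using ok by (simp only: totals_ok_def of_int_le_iff)
    moreover have "real N \<le> real_of_int L'" using N by linarith
    ultimately show ?thesis using m(2) by simp
  qed
  also note tot(3)
  finally have "real m \<le> real (prod_list xs)"
    using m(1) tot(4) by (subst (asm) ln_le_cancel_iff) auto
  then have prod: "m \<le> prod_list xs" by simp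
  define ps where "ps = map (\<lambda>p. (p, 1 :: nat)) xs"
  have "moduli ps = xs" "map fst ps = xs" "length ps = k"
    by (simp_all add: ps_def moduli_def k_def comp_def)
  moreover have "distinct xs"
    unfolding xs_def cls_def by (rule distinct_class_segment)
  moreover have "\<forall>(p, e)\<in>set ps. prime p \<and> e \<ge> 1" using tot(5) by (auto simp: ps_def)
  ultimately have "good_sequence N m ps"
    using k s prod by (simp add: good_sequence_def s_def)
  then show ?thesis by blast
qed

lemma good_sequence_exists:
  assumes "2 \<le> N" "1 \<le> m" "ln (real m) \<le> real N / 2"
  shows "\<exists>ps. good_sequence (real N) m ps"
proof (cases "4000 \<le> N")
  case True
  then show ?thesis using assms by (intro good_sequence_large)
next
  case False
  then have "2 \<le> int N" "int N \<le> 3999" using assms(1) by auto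
  from coversD[OF covers_segment_table this] obtain L L' i j v where
    c: "(L, L', i, j, v) \<in> set segment_table" "L \<le> int N" "int N \<le> L'"
    by auto
  have "segment_ok (L, L', i, j, v)"
    using segment_table c(1) by (simp add: list_all_iff)
  from good_sequence_segment[OF this c(2,3) assms(2,3)] show ?thesis .
qed

theorem theorem1:
  "\<exists>(P :: com) (C :: nat). \<forall>(n :: nat) (d :: nat). 1 \<le> d \<and> d < n \<longrightarrow>
     (\<exists>ps :: (nat \<times> nat) list.
        let T = crs_tests n ps; L = real_of_int \<lceil>2 * real d * ln (real n)\<rceil> in
        crs_sequence n d ps \<and>
        identifies T n d \<and>
        real (length T) < L ^ 2 / (2 * ln L) * (1 + 1.2762 / ln L) \<and>
        real (sampling_rate T n) < L / (2 * ln L) * (1 + 1.2762 / ln L) \<and>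
        analyses_within P n d ps (C * (n * length T)))"
\<comment> \<open>Program and constant are fixed before \<open>n\<close> and \<open>d\<close>, so
  the time bound is uniform.\<close>
proof (intro exI[of _ analyser] exI[of _ "30 :: nat"] allI impI)
  fix n d :: nat assume "1 \<le> d \<and> d < n"
  then have d: "1 \<le> d" and n: "2 \<le> n" by auto
  define L where "L = real_of_int \<lceil>2 * real d * ln (real n)\<rceil>"
  define N where "N = nat \<lceil>2 * real d * ln (real n)\<rceil>"
  have "1 * ln 2 \<le> real d * ln (real n)" using d n by (intro mult_mono) auto
  \<comment> \<open>A value above 1 has ceiling at least 2, as \<open>good_sequence_exists\<close>
    requires.\<close>
  then have big: "1 < 2 * real d * ln (real n)" using ln_2_bounds by simp
  then have N: "real N = L" "2 \<le> N" unfolding N_def L_def by linarith+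
  have "ln (real (n ^ d)) = real d * ln (real n)" using n by (simp add: ln_realpow)
  also have "\<dots> \<le> real N / 2" unfolding N(1) L_def by linarith
  finally obtain ps where good: "good_sequence (real N) (n ^ d) ps"
    using good_sequence_exists[OF N(2), of "n ^ d"] n by auto
  then have crs: "crs_sequence n d ps" by (simp add: good_sequence_def crs_sequence_def)
  have "length (crs_tests n ps) = sum_list (moduli ps)"
    by (simp add: length_crs_tests moduli_def)
  then have "real (length (crs_tests n ps)) < L * rate L"
    using good by (simp add: good_sequence_def N(1))
  also have "L * rate L = L ^ 2 / (2 * ln L) * (1 + 1.2762 / ln L)"
    by (simp add: rate_def power2_eq_square)
  finally have len: "real (length (crs_tests n ps)) < L ^ 2 / (2 * ln L) * (1 + 1.2762 / ln L)" .
  have "0 \<notin> set (moduli ps)" using crs by (auto simp: moduli_def crs_sequence_def)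
  then have "sampling_rate (crs_tests n ps) n = length ps"
    using n by (intro sampling_rate_crs_tests) auto
  then have "real (sampling_rate (crs_tests n ps) n) < L / (2 * ln L) * (1 + 1.2762 / ln L)"
    using good by (simp add: good_sequence_def N(1) rate_def)
  then show "\<exists>ps. let T = crs_tests n ps; L = real_of_int \<lceil>2 * real d * ln (real n)\<rceil> in
        crs_sequence n d ps \<and> identifies T n d \<and>
        real (length T) < L ^ 2 / (2 * ln L) * (1 + 1.2762 / ln L) \<and>
        real (sampling_rate T n) < L / (2 * ln L) * (1 + 1.2762 / ln L) \<and>
        analyses_within analyser n d ps (30 * (n * length T))"
    using crs len identifies_crs_tests[OF crs n d] analyses_within_analyser[OF crs n d]
    unfolding Let_def L_def by (intro exI[of _ ps]) blast
qed

end
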